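(* Let $X$ be a locally compact second countable space on which the group $B$ acts continuously, and let $(\mu_k)_{k=1}^\infty$ be $\mathtt{a}$-invariant and ergodic probability measures on $X$ such that each $\mu_k$ is $\mathtt{u}$-free. Suppose that the $\mathtt{u}$-leafwise dimensions satisfy $\dim^{\mathtt{u}}\mu_k\to 1$ as $k\to\infty$, and that $(\mu_k)$ converges in the weak-$*$ topology to a probability measure $\mu_\infty$ on $X$. Then $\mu_\infty$ is $\mathtt{u}$-invariant, i.e. $\mathtt{u}(s)_*\mu_\infty=\mu_\infty$ for all $s\in\mathbb{R}$.
   Context: $B\cong\mathbb{R}\ltimes\mathbb{R}$ is the group generated by one-parameter subgroups $\mathtt{a}(t),\mathtt{u}(s)$ ($t,s\in\mathbb{R}$) with $\mathtt{a}(t)\mathtt{u}(s)\mathtt{a}(-t)=\mathtt{u}(e^ts)$ (concretely $\mathtt{a}(t)=\mathrm{diag}(e^{t/2},e^{-t/2})$ and $\mathtt{u}(s)=\begin{pmatrix}1&s\\0&1\end{pmatrix}$ in $\mathrm{SL}_2(\mathbb{R})$). "$\mathtt{a}$-invariant and ergodic" means invariant and ergodic under $\{\mathtt{a}(t)\}_{t\in\mathbb{R}}$. A measure $\mu$ on $X$ is $\mathtt{u}$-free if for $\mu$-a.e. $x$ the stabilizer $\{s:\mathtt{u}(s).x=x\}$ is $\{0\}$. Leafwise measures: for $f:\mathbb{R}\to\mathbb{R}$ nonnegative integrable with $\int f=1$ put $S_f\mu=\int_{\mathbb{R}}f(s)\,\mathtt{u}(-s).\mu\,ds$. For a $\mathtt{u}$-free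 probability measure $\mu$, the leafwise measures are a measurable map $y\mapsto\mu_y^{\mathtt{u}}$ from $X$ to locally finite measures on $\mathbb{R}$ (unique up to proportionality, for $\mu$-a.e. $y$) such that: (i) for all $s\in\mathbb{R}$, $y\in X$, $\mu^{\mathtt{u}}_{\mathtt{u}(s).y}$ is proportional to the pushforward of $\mu^{\mathtt{u}}_y$ by $r\mapsto r-s$; (ii) for every nonnegative integrable $f:\mathbb{R}\to\mathbb{R}$ with $\int f=1$, for $S_f\mu$-a.e. $y$ one has $0<\mu_y^{\mathtt{u}}(f)<\infty$, and $F_*\big(\mu\times (f\cdot m_{\mathbb{R}})\big)=\int_X\delta_y\times\frac{f\cdot\mu^{\mathtt{u}}_y}{\mu^{\mathtt{u}}_y(f)}\,dS_f\mu(y)$, where $F(x,s)=(\mathtt{u}(-s)x,s)$ on $X\times\mathbb{R}$ and $m_{\mathbb{R}}$ is Lebesgue measure. Leafwise dimension: an $\mathtt{a}$-invariant $\mathtt{u}$-free probability measure $\mu$ has $\mathtt{u}$-leafwise dimension $\dim^{\mathtt{u}}(\mu)=\delta$ if for $\mu$-a.e. $x$, $\lim_{t\to\infty}\frac1t\log\mu_x^{\mathtt{u}}([-e^{-t},e^{-t}])=-\delta$. It is known to exist when $\mu$ is ergodic. *)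

theory Defs
  imports "HOL-Probability.Probability" "HOL-Algebra.Generated_Groups" "HOL-Algebra.Group_Action"
begin

definition a_elt :: "real \<Rightarrow> real^2^2" where
  "a_elt t = vector [vector [exp (t / 2), 0], vector [0, exp (- t / 2)]]"

definition u_elt :: "real \<Rightarrow> real^2^2" where
  "u_elt s = vector [vector [1, s], vector [0, 1]]"

definition SL2 :: "(real^2^2) monoid" where
  "SL2 = \<lparr>carrier = {A. det A = 1}, mult = (**), one = mat 1\<rparr>"

definition B_grp :: "(real^2^2) monoid" where
  "B_grp = SL2\<lparr>carrier := generate SL2 (range a_elt \<union> range u_elt)\<rparr>"

(* Joint continuity; the group carries the subspace topology of the 2x2 matrices. *)
definition continuous_B_action :: "(real^2^2 \<Rightarrow> 'a \<Rightarrow> 'a::topological_space) \<Rightarrow> bool" where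
  "continuous_B_action \<phi> \<longleftrightarrow>
     group_action B_grp UNIV \<phi> \<and>
     continuous_on (carrier B_grp \<times> UNIV) (\<lambda>(g, x). \<phi> g x)"

definition borel_prob :: "'a::topological_space measure \<Rightarrow> bool" where
  "borel_prob \<mu> \<longleftrightarrow> prob_space \<mu> \<and> sets \<mu> = sets borel"

definition a_invariant :: "(real^2^2 \<Rightarrow> 'a \<Rightarrow> 'a::topological_space) \<Rightarrow> 'a measure \<Rightarrow> bool" where
  "a_invariant \<phi> \<mu> \<longleftrightarrow> (\<forall>t. distr \<mu> borel (\<phi> (a_elt t)) = \<mu>)"

definition u_invariant :: "(real^2^2 \<Rightarrow> 'a \<Rightarrow> 'a::topological_space) \<Rightarrow> 'a measure \<Rightarrow> bool" where
  "u_invariant \<phi> \<mu> \<longleftrightarrow> (\<forall>s. distr \<mu> borel (\<phi> (u_elt s)) = \<mu>)"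

definition a_ergodic :: "(real^2^2 \<Rightarrow> 'a \<Rightarrow> 'a::topological_space) \<Rightarrow> 'a measure \<Rightarrow> bool" where
  "a_ergodic \<phi> \<mu> \<longleftrightarrow>
     (\<forall>A\<in>sets borel. (\<forall>t. \<phi> (a_elt t) -` A = A) \<longrightarrow>
        measure \<mu> A = 0 \<or> measure \<mu> A = 1)"

definition u_free :: "(real^2^2 \<Rightarrow> 'a \<Rightarrow> 'a::topological_space) \<Rightarrow> 'a measure \<Rightarrow> bool" where
  "u_free \<phi> \<mu> \<longleftrightarrow> (AE x in \<mu>. {s. \<phi> (u_elt s) x = x} = {0})"

definition prob_density :: "(real \<Rightarrow> real) \<Rightarrow> bool" where
  "prob_density f \<longleftrightarrow>
     (\<forall>s. 0 \<le> f s) \<and> integrable lborel f \<and> (\<integral>s. f s \<partial>lborel) = 1"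

(* S_f mu = integral of f(s) u(-s).mu ds, as an integral of measures. *)
definition u_smear ::
  "(real^2^2 \<Rightarrow> 'a \<Rightarrow> 'a::topological_space) \<Rightarrow> (real \<Rightarrow> real) \<Rightarrow> 'a measure \<Rightarrow> 'a measure" where
  "u_smear \<phi> f \<mu> =
     density lborel (\<lambda>s. ennreal (f s)) \<bind> (\<lambda>s. distr \<mu> borel (\<phi> (u_elt (- s))))"

definition locally_finite_measure :: "real measure \<Rightarrow> bool" where
  "locally_finite_measure \<nu> \<longleftrightarrow>
     sets \<nu> = sets borel \<and> (\<forall>K. compact K \<longrightarrow> emeasure \<nu> K < \<infinity>)"

(* The space of locally finite measures carries the sigma-algebra generated by the
   evaluations at Borel sets.  In the last clause the kernel is a sub-probability kernel at
   every y (it is the zero measure where the normalising integral is 0 or infinite), so the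
   Giry bind is the integral of measures also across the exceptional null set. *)
definition leafwise_measures ::
  "(real^2^2 \<Rightarrow> 'a \<Rightarrow> 'a::topological_space) \<Rightarrow> 'a measure \<Rightarrow> ('a \<Rightarrow> real measure) \<Rightarrow> bool" where
  "leafwise_measures \<phi> \<mu> \<nu> \<longleftrightarrow>
     (\<forall>y. locally_finite_measure (\<nu> y)) \<and>
     (\<forall>A\<in>sets borel. (\<lambda>y. emeasure (\<nu> y) A) \<in> borel_measurable borel) \<and>
     (\<forall>s y. \<exists>c>0. \<nu> (\<phi> (u_elt s) y) =
        scale_measure (ennreal c) (distr (\<nu> y) borel (\<lambda>r. r - s))) \<and>
     (\<forall>f. prob_density f \<longrightarrow>
        (AE y in u_smear \<phi> f \<mu>.
           0 < (\<integral>\<^sup>+ r. ennreal (f r) \<partial>\<nu> y) \<and> (\<integral>\<^sup>+ r. ennreal (f r) \<partial>\<nu> y) < \<infinity>) \<and>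
        distr (\<mu> \<Otimes>\<^sub>M density lborel (\<lambda>s. ennreal (f s))) (borel \<Otimes>\<^sub>M borel)
          (\<lambda>(x, s). (\<phi> (u_elt (- s)) x, s)) =
        u_smear \<phi> f \<mu> \<bind>
          (\<lambda>y. return borel y \<Otimes>\<^sub>M
             density (\<nu> y) (\<lambda>s. ennreal (f s) / (\<integral>\<^sup>+ r. ennreal (f r) \<partial>\<nu> y))))"

(* Leafwise measures are unique up to a scalar for almost every point, so the choice of the
   family does not affect the dimension.  The positivity conjunct is part of the limit
   statement: on paper log 0 = -infinity, which rules out null intervals when the limit is
   finite, whereas here ln 0 = 0. *)
definition has_leafwise_dim ::
  "(real^2^2 \<Rightarrow> 'a \<Rightarrow> 'a::topological_space) \<Rightarrow> 'a measure \<Rightarrow> real \<Rightarrow> bool" where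
  "has_leafwise_dim \<phi> \<mu> \<delta> \<longleftrightarrow>
     (\<exists>\<nu>. leafwise_measures \<phi> \<mu> \<nu> \<and>
        (AE x in \<mu>.
           (\<forall>t. 0 < measure (\<nu> x) {- exp (- t)..exp (- t)}) \<and>
           ((\<lambda>t. 1 / t * ln (measure (\<nu> x) {- exp (- t)..exp (- t)})) \<longlongrightarrow> - \<delta>) at_top))"

definition weak_star_limit ::
  "(nat \<Rightarrow> 'a::topological_space measure) \<Rightarrow> 'a measure \<Rightarrow> bool" where
  "weak_star_limit \<mu> \<mu>' \<longleftrightarrow>
     (\<forall>f::'a \<Rightarrow> real. continuous_on UNIV f \<and> compact (closure {x. f x \<noteq> 0}) \<longrightarrow>
        (\<lambda>k. \<integral>x. f x \<partial>\<mu> k) \<longlonglongrightarrow> (\<integral>x. f x \<partial>\<mu>'))"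

end

theory Submission
  imports Defs
begin

text \<open>
  The proof compares entropies of binary digits. Let \<open>\<mu>\<close> be \<open>a\<close>-invariant with leafwise dimension
  \<open>\<delta>\<close>. Choose \<open>x\<close> by \<open>\<mu>\<close> and \<open>s\<close> uniformly in \<open>[0, 1)\<close>, independently, and put \<open>y = u (-s) x\<close>. Given
  \<open>y\<close>, the law of \<open>s\<close> is the normalized restriction to \<open>[0, 1)\<close> of the leafwise measure at \<open>y\<close>
  (\<open>leafwise_disintegration\<close>). The dimension says that \<open>n\<close> binary digits of \<open>s\<close> carry conditional
  information at least about \<open>n * \<delta> * ln 2\<close> (\<open>liminf_information_ge\<close>). Applying \<open>a (ln 2)\<close> and
  shifting the digits of \<open>s\<close> preserves the law of \<open>(y, s)\<close> (\<open>unit_expectation_invariant\<close>), so any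
  rule that guesses the first digit from \<open>y\<close> extends to all digits, and its cross entropy for \<open>n\<close>
  digits is \<open>n\<close> times that for one digit (\<open>unit_expectation_digit_weight\<close>). By Gibbs' inequality
  (\<open>conditional_entropy_le\<close>) and Fatou's lemma, every such rule has cross entropy at least
  \<open>\<delta> * ln 2\<close> (\<open>leafwise_dim_le_cross_entropy\<close>).

  For a test function \<open>g\<close> with \<open>\<bar>g\<bar> \<le> 1\<close>, the rule giving the digit \<open>0\<close> the probability
  \<open>(1 + \<theta> * g y) / 2\<close> shows that \<open>\<theta>\<close> times the \<open>\<mu>\<close>-mean over \<open>x\<close> of the difference between
  the integrals of \<open>g (u (-s) x)\<close> over \<open>0 \<le> s < 1/2\<close> and over \<open>1/2 \<le> s < 1\<close> is at most \<open>(1 - \<delta>) * ln 2 + 2 * \<theta>\<^sup>2\<close>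
  (\<open>half_difference_bound\<close>). The difference is a continuous function of \<open>x\<close> with compact support if
  \<open>g\<close> is. Thus as \<open>\<delta>\<close> tends to \<open>1\<close>, and then \<open>\<theta>\<close> to \<open>0\<close>, its integral against the weak limit
  vanishes (\<open>limit_half_difference\<close>). Rescaling by \<open>a\<close>, the function \<open>G s = \<integral> g (u (-s) x)\<close> of
  the weak limit has equal averages on the two halves of every interval \<open>[0, L]\<close>; it is continuous,
  hence constant on \<open>[0, \<infinity>)\<close> (\<open>average_halves_imp_constant\<close>). This is the invariance of the limit,
  because measures are determined by continuous functions with compact support
  (\<open>borel_measure_eqI_C_c\<close>).
\<close>

section \<open>Continuous actions of the affine group\<close>

lemma u_elt_add: "u_elt s ** u_elt r = u_elt (s + r)"
  by (simp add: u_elt_def matrix_matrix_mult_def vec_eq_iff forall_2 sum_2)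

lemma a_elt_add: "a_elt s ** a_elt t = a_elt (s + t)"
  by (simp add: a_elt_def matrix_matrix_mult_def vec_eq_iff forall_2 sum_2 exp_add[symmetric] field_simps)

lemma a_elt_u_elt: "a_elt t ** u_elt s = u_elt (exp t * s) ** a_elt t"
  by (simp add: a_elt_def u_elt_def matrix_matrix_mult_def vec_eq_iff forall_2 sum_2
      exp_add[symmetric])

lemma u_elt_0: "u_elt 0 = mat 1" and a_elt_0: "a_elt 0 = mat 1"
  by (simp_all add: a_elt_def u_elt_def mat_def vec_eq_iff forall_2)

lemma a_elt_in_B: "a_elt t \<in> carrier B_grp" and u_elt_in_B: "u_elt s \<in> carrier B_grp"
  by (auto simp: B_grp_def intro: generate.incl)

lemma continuous_u_elt: "continuous_on UNIV u_elt"
proof -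
  have "continuous_on UNIV (\<lambda>s. u_elt s $ i $ j)" for i j
    using exhaust_2[of i] exhaust_2[of j] by (elim disjE) (simp_all add: u_elt_def)
  then show ?thesis
    by (auto simp: continuous_on_def intro!: vec_tendstoI)
qed

text \<open>A continuous action of \<open>B\<close>, with the two one-parameter flows \<open>a t\<close> and \<open>u s\<close> on
  the space.\<close>

locale B_action =
  fixes \<phi> :: "real^2^2 \<Rightarrow> 'a \<Rightarrow> 'a::{second_countable_topology, t2_space}"
  assumes continuous_action: "continuous_B_action \<phi>"
begin

abbreviation a :: "real \<Rightarrow> 'a \<Rightarrow> 'a" where "a t \<equiv> \<phi> (a_elt t)"
abbreviation u :: "real \<Rightarrow> 'a \<Rightarrow> 'a" where "u s \<equiv> \<phi> (u_elt s)"

lemma group_action_B: "group_action B_grp UNIV \<phi>"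
  using continuous_action by (simp add: continuous_B_action_def)

lemma action_mult:
  "g \<in> carrier B_grp \<Longrightarrow> h \<in> carrier B_grp \<Longrightarrow> \<phi> (g ** h) x = \<phi> g (\<phi> h x)"
  using group_action.composition_rule[OF group_action_B, of x g h]
  by (simp add: B_grp_def SL2_def)

lemma action_one: "\<phi> (mat 1) x = x"
  using group_action.id_eq_one[OF group_action_B] by (simp add: B_grp_def SL2_def fun_eq_iff)

lemma u_u: "u s (u r x) = u (s + r) x"
  by (simp add: action_mult[symmetric] u_elt_in_B u_elt_add)

lemma a_a: "a s (a t x) = a (s + t) x"
  by (simp add: action_mult[symmetric] a_elt_in_B a_elt_add)

lemma a_u: "a t (u s x) = u (exp t * s) (a t x)"
  by (simp add: action_mult[symmetric] a_elt_in_B u_elt_in_B a_elt_u_elt)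

lemma u_0 [simp]: "u 0 x = x" and a_0 [simp]: "a 0 x = x"
  by (simp_all add: u_elt_0 a_elt_0 action_one)

lemma continuous_on_action: "continuous_on (carrier B_grp \<times> UNIV) (\<lambda>(g, x). \<phi> g x)"
  using continuous_action by (simp add: continuous_B_action_def)

lemma continuous_on_u: "continuous_on UNIV (\<lambda>(x, s). u s x)"
proof -
  have "continuous_on UNIV (\<lambda>z::'a \<times> real. (u_elt (snd z), fst z))"
    by (intro continuous_intros continuous_on_compose2[OF continuous_u_elt]) simp
  from continuous_on_compose2[OF continuous_on_action this] show ?thesis
    by (simp add: image_subset_iff u_elt_in_B split_def)
qed

lemma continuous_on_a: "continuous_on UNIV (a t)"
proof -
  have "continuous_on UNIV (\<lambda>x::'a. (a_elt t, x))"
    by (intro continuous_intros)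
  from continuous_on_compose2[OF continuous_on_action this] show ?thesis
    by (simp add: image_subset_iff a_elt_in_B)
qed

lemma continuous_on_u_compose [continuous_intros]:
  assumes "continuous_on S f" "continuous_on S g"
  shows "continuous_on S (\<lambda>z. u (f z) (g z))"
proof -
  have "continuous_on S (\<lambda>z. (\<lambda>(x, s). u s x) (g z, f z))"
    by (rule continuous_on_compose2[OF continuous_on_u]) (auto intro!: continuous_intros assms)
  then show ?thesis by simp
qed

lemma continuous_on_a_compose [continuous_intros]:
  "continuous_on S g \<Longrightarrow> continuous_on S (\<lambda>z. a t (g z))"
  by (rule continuous_on_compose2[OF continuous_on_a]) auto

lemma borel_measurable_u [measurable]:
  assumes "f \<in> borel_measurable M" "g \<in> borel_measurable M"
  shows "(\<lambda>z. u (f z) (g z)) \<in> borel_measurable M"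
proof -
  have "(\<lambda>(x, s). u s x) \<in> borel_measurable (borel :: ('a \<times> real) measure)"
    by (rule borel_measurable_continuous_onI[OF continuous_on_u])
  then have m: "(\<lambda>(x, s). u s x) \<in> borel_measurable (borel \<Otimes>\<^sub>M borel)"
    by (simp add: borel_prod)
  have "(\<lambda>z. (\<lambda>(x, s). u s x) (g z, f z)) \<in> borel_measurable M"
    by (rule measurable_compose[OF _ m]) (use assms in measurable)
  then show ?thesis by simp
qed

lemma borel_measurable_a [measurable]:
  "g \<in> borel_measurable M \<Longrightarrow> (\<lambda>z. a t (g z)) \<in> borel_measurable M"
  by (rule measurable_compose[OF _ borel_measurable_continuous_onI[OF continuous_on_a]])

end

section \<open>Continuous functions with compact support\<close>

text \<open>The continuous real functions with compact support.\<close>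

definition C_c :: "('a::topological_space \<Rightarrow> real) set" where
  "C_c = {g. continuous_on UNIV g \<and> compact (closure {x. g x \<noteq> 0})}"

lemma C_cI:
  fixes g :: "'a::t2_space \<Rightarrow> real"
  assumes "continuous_on UNIV g" "compact K" "\<And>x. x \<notin> K \<Longrightarrow> g x = 0"
  shows "g \<in> C_c"
proof -
  have "closure {x. g x \<noteq> 0} \<subseteq> K"
    using assms by (intro closure_minimal compact_imp_closed) auto
  then show ?thesis
    using assms(1) compact_Int_closed[OF assms(2) closed_closure, of "{x. g x \<noteq> 0}"]
    by (simp add: C_c_def Int_absorb1)
qed

lemma C_c_continuous: "g \<in> C_c \<Longrightarrow> continuous_on S g"
  by (auto simp: C_c_def intro: continuous_on_subset)

lemma C_c_measurable: "g \<in> C_c \<Longrightarrow> g \<in> borel_measurable borel"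
  by (intro borel_measurable_continuous_onI C_c_continuous)

lemma C_c_support:
  assumes "g \<in> C_c"
  obtains K where "compact K" "\<And>x. x \<notin> K \<Longrightarrow> g x = 0"
proof (rule that)
  show "compact (closure {x. g x \<noteq> 0})" using assms by (simp add: C_c_def)
  show "g x = 0" if "x \<notin> closure {x. g x \<noteq> 0}" for x
    using that closure_subset[of "{x. g x \<noteq> 0}"] by blast
qed

lemma C_c_sum:
  fixes g :: "'i \<Rightarrow> 'a::t2_space \<Rightarrow> real"
  shows "finite I \<Longrightarrow> (\<And>i. i \<in> I \<Longrightarrow> g i \<in> C_c) \<Longrightarrow> (\<lambda>x. \<Sum>i\<in>I. g i x) \<in> C_c"
proof (induction rule: finite_induct)
  case empty
  show ?case by (auto simp: C_c_def)
next
  case (insert i I)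
  obtain K where "compact K" "\<And>x. x \<notin> K \<Longrightarrow> g i x = 0"
    using C_c_support[of "g i"] insert by auto
  moreover obtain L where "compact L" "\<And>x. x \<notin> L \<Longrightarrow> (\<Sum>i\<in>I. g i x) = 0"
    using C_c_support[of "\<lambda>x. \<Sum>i\<in>I. g i x"] insert by auto
  moreover have "continuous_on UNIV (\<lambda>x. \<Sum>j\<in>insert i I. g j x)"
    using insert by (intro continuous_intros C_c_continuous) auto
  ultimately show ?case
    using insert.hyps by (intro C_cI[of _ "K \<union> L"]) auto
qed

text \<open>Locally compact Hausdorff spaces are completely regular; cutting down to a relatively
  compact neighbourhood of the point makes the support compact.\<close>

lemma bump_function:
  fixes U :: "'a::t2_space set"
  assumes lc: "locally_compact_space (euclidean :: 'a topology)"
    and U: "open U" "x \<in> U"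
  obtains g where "g \<in> C_c" "\<And>y. 0 \<le> g y" "g x > 0" "\<And>y. y \<notin> U \<Longrightarrow> g y = 0"
proof -
  obtain V K where V: "open V" "compact K" "x \<in> V" "V \<subseteq> K"
    using lc unfolding locally_compact_space_def by (metis UNIV_I compactin_euclidean_iff open_openin topspace_euclidean)
  have "Hausdorff_space (euclidean :: 'a topology)"
    by (simp add: Hausdorff_space_def disjnt_def) (meson hausdorff)
  then have "completely_regular_space (euclidean :: 'a topology)"
    using lc locally_compact_regular_imp_completely_regular_space by blast
  moreover have "closedin euclidean (- (U \<inter> V))" using U V by auto
  ultimately obtain f :: "'a \<Rightarrow> real" where f: "continuous_map euclidean (top_of_set {0..1}) f"
      "f x = 0" "f ` (- (U \<inter> V)) \<subseteq> {1}"
    unfolding completely_regular_space_def using U V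
    by (metis Compl_iff DiffI IntI UNIV_I topspace_euclidean)
  have c: "continuous_on UNIV f" and r: "\<And>y. f y \<in> {0..1}"
    using f(1) by (auto simp: continuous_map_in_subtopology)
  show thesis
  proof
    have "1 - f y = 0" if "y \<notin> K" for y using f(3) that V by auto
    with V show "(\<lambda>y. 1 - f y) \<in> C_c"
      by (intro C_cI[of _ K]) (auto intro!: continuous_intros c)
  qed (use f r in \<open>auto\<close>)
qed

text \<open>Borel probability measures on a locally compact second countable Hausdorff space are
  determined by their integrals on \<^term>\<open>C_c\<close>. By the Lindelof property an open set is a
  countable union of positivity sets of bump functions, so its indicator is a bounded pointwise
  limit of functions in \<^term>\<open>C_c\<close>, and the open sets generate the Borel sets.\<close>

lemma borel_measure_eqI_C_c:
  fixes M N :: "'a::{second_countable_topology, t2_space} measure"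
  assumes lc: "locally_compact_space (euclidean :: 'a topology)"
    and M: "prob_space M" "sets M = sets borel"
    and N: "prob_space N" "sets N = sets borel"
    and eq: "\<And>g. g \<in> C_c \<Longrightarrow> (\<And>x. 0 \<le> g x) \<Longrightarrow> (\<And>x. g x \<le> 1) \<Longrightarrow>
      (\<integral>x. g x \<partial>M) = (\<integral>x. g x \<partial>N)"
  shows "M = N"
proof (rule measure_eqI_generator_eq[where E="{U. open U}" and \<Omega>=UNIV and A="\<lambda>_. UNIV"])
  interpret M: prob_space M by fact
  interpret N: prob_space N by fact
  show "Int_stable {U :: 'a set. open U}" by (auto simp: Int_stable_def)
  show "sets M = sigma_sets UNIV {U. open U}" "sets N = sigma_sets UNIV {U. open U}"
    using M N by (auto simp: borel_def)
  show "emeasure M UNIV \<noteq> \<infinity>" by simp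
  show "emeasure M U = emeasure N U" if "U \<in> {U. open U}" for U
  proof -
    have "\<forall>x\<in>U. \<exists>g. g \<in> C_c \<and> (\<forall>y. 0 \<le> g y) \<and> g x > 0 \<and> (\<forall>y. y \<notin> U \<longrightarrow> g y = (0::real))"
      using bump_function[OF lc] that by (metis mem_Collect_eq)
    then obtain g where g: "\<And>x. x \<in> U \<Longrightarrow> g x \<in> C_c" "\<And>x y. x \<in> U \<Longrightarrow> 0 \<le> g x y"
      "\<And>x. x \<in> U \<Longrightarrow> g x x > 0" "\<And>x y. x \<in> U \<Longrightarrow> y \<notin> U \<Longrightarrow> g x y = (0::real)"
      by metis
    have op: "open {y. g x y > 0}" if "x \<in> U" for x
      by (intro open_Collect_less continuous_on_const C_c_continuous g that)
    obtain F where F: "F \<subseteq> (\<lambda>x. {y. g x y > 0}) ` U" "countable F"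
        "\<Union>F = (\<Union>x\<in>U. {y. g x y > 0})"
      using Lindelof[of "(\<lambda>x. {y. g x y > 0}) ` U"] op by auto
    obtain D where D: "D \<subseteq> U" "countable D" "F = (\<lambda>x. {y. g x y > 0}) ` D"
      using F(1,2) by (metis countable_subset_image)
    have cover: "\<exists>d\<in>D. g d y > 0" if "y \<in> U" for y
    proof -
      have "y \<in> (\<Union>x\<in>U. {y. g x y > 0})" using g(3) that by auto
      then show ?thesis unfolding F(3)[symmetric] D(3) by auto
    qed
    show ?thesis
    proof (cases "U = {}")
      case False
      then have "D \<noteq> {}" using cover by auto
      then obtain e :: "nat \<Rightarrow> 'a" where e: "range e = D"
        using D(2) by (metis range_from_nat_into)
      then have eU: "e i \<in> U" for i using D(1) by auto
      define f where "f n y = min 1 (real n * (\<Sum>i<n. g (e i) y))" for n y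
      have fC: "f n \<in> C_c" for n
      proof -
        have s: "(\<lambda>y. \<Sum>i<n. g (e i) y) \<in> C_c"
          by (intro C_c_sum) (auto intro: g eU)
        obtain K where "compact K" "\<And>y. y \<notin> K \<Longrightarrow> (\<Sum>i<n. g (e i) y) = 0"
          using C_c_support[OF s] by blast
        moreover have "continuous_on UNIV (f n)"
          unfolding f_def by (intro continuous_intros C_c_continuous s)
        ultimately show ?thesis
          by (auto simp: f_def intro: C_cI)
      qed
      have f01: "0 \<le> f n y" "f n y \<le> 1" for n y
        by (auto simp: f_def intro!: mult_nonneg_nonneg sum_nonneg g eU)
      have lim: "(\<lambda>n. f n y) \<longlonglongrightarrow> indicator U y" for y
      proof (cases "y \<in> U")
        case True
        obtain i where i: "g (e i) y > 0" using cover[OF True] e by auto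
        obtain m where m: "real m * g (e i) y > 1"
          using reals_Archimedean3[OF i] by blast
        have "f n y = 1" if "n \<ge> max m (Suc i)" for n
        proof -
          have "1 < real m * g (e i) y" by fact
          also have "\<dots> \<le> real n * (\<Sum>i<n. g (e i) y)"
            using that i member_le_sum[of i "{..<n}" "\<lambda>i. g (e i) y"]
            by (intro mult_mono) (auto intro!: g eU)
          finally show ?thesis by (simp add: f_def)
        qed
        then have "eventually (\<lambda>n. f n y = 1) sequentially"
          unfolding eventually_sequentially by blast
        then show ?thesis using True by (simp add: tendsto_eventually)
      next
        case False
        then have "f n y = 0" for n by (simp add: f_def g(4)[OF eU])
        then show ?thesis using False by simp
      qed
      have meas: "f n \<in> borel_measurable borel" for n by (intro C_c_measurable fC)
      have U': "U \<in> sets borel" using that by auto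
      have "(\<lambda>n. \<integral>x. f n x \<partial>L) \<longlonglongrightarrow> measure L U"
        if L: "prob_space L" "sets L = sets borel" for L
      proof -
        interpret L: prob_space L by fact
        have "(\<lambda>n. \<integral>x. f n x \<partial>L) \<longlonglongrightarrow> (\<integral>x. indicator U x \<partial>L)"
          using meas U' L(2) f01
          by (intro integral_dominated_convergence[where w="\<lambda>_. 1"])
             (auto intro!: lim cong: measurable_cong_sets)
        then show ?thesis using L(2) U' by simp
      qed
      from this[OF M] this[OF N] have "measure M U = measure N U"
        using eq[OF fC f01] by (auto intro: LIMSEQ_unique)
      then show ?thesis
        by (simp add: M.emeasure_eq_measure N.emeasure_eq_measure)
    qed simp
  qed
qed auto

section \<open>Binary digits and renormalization\<close>

text \<open>The integer whose binary expansion is given by the first \<open>n\<close> binary digits of a point \<open>s\<close>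
  of the unit interval; doubling the fractional part shifts the digits.\<close>

definition dyadic_cell :: "nat \<Rightarrow> real \<Rightarrow> nat" where
  "dyadic_cell n s = nat \<lfloor>2 ^ n * s\<rfloor>"

lemma dyadic_cell_less: "s \<in> {0..<1} \<Longrightarrow> dyadic_cell n s < 2 ^ n"
proof -
  assume "s \<in> {0..<1}"
  then have "\<lfloor>2 ^ n * s\<rfloor> < 2 ^ n" by (simp add: floor_less_iff)
  then show ?thesis by (simp add: dyadic_cell_def nat_less_iff)
qed

lemma dyadic_cell_Suc:
  assumes "s \<in> {0..<1}"
  shows "s < 1/2 \<Longrightarrow> dyadic_cell (Suc n) s = dyadic_cell n (frac (2 * s))"
    and "s \<ge> 1/2 \<Longrightarrow> dyadic_cell (Suc n) s = 2 ^ n + dyadic_cell n (frac (2 * s))"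
proof -
  assume s: "s < 1/2"
  then have "\<lfloor>2 * s\<rfloor> = 0" using assms by (intro floor_unique) auto
  then show "dyadic_cell (Suc n) s = dyadic_cell n (frac (2 * s))"
    by (simp add: dyadic_cell_def frac_def algebra_simps)
next
  assume s: "s \<ge> 1/2"
  then have f: "\<lfloor>2 * s\<rfloor> = 1" using assms by (intro floor_unique) auto
  have "2 ^ Suc n * s = 2 ^ n * (2 * s - 1) + of_int (2 ^ n)" by (simp add: algebra_simps)
  then have "\<lfloor>2 ^ Suc n * s\<rfloor> = \<lfloor>2 ^ n * (2 * s - 1)\<rfloor> + 2 ^ n"
    by (metis floor_add_int)
  moreover have "\<lfloor>2 ^ n * (2 * s - 1)\<rfloor> \<ge> 0" using s by simp
  ultimately show "dyadic_cell (Suc n) s = 2 ^ n + dyadic_cell n (frac (2 * s))"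
    by (simp add: dyadic_cell_def frac_def f nat_add_distrib nat_power_eq)
qed

lemma measurable_dyadic_cell [measurable]: "dyadic_cell n \<in> borel \<rightarrow>\<^sub>M count_space UNIV"
  unfolding dyadic_cell_def by measurable

lemma nn_integral_doubling:
  fixes h :: "real \<Rightarrow> ennreal"
  assumes [measurable]: "h \<in> borel_measurable borel"
  shows "(\<integral>\<^sup>+s. indicator {0..<1} s * h (frac (2 * s)) \<partial>lborel) =
    (\<integral>\<^sup>+s. indicator {0..<1} s * h s \<partial>lborel)"
proof -
  have [measurable]: "frac \<in> borel_measurable (borel :: real measure)"
    unfolding frac_def by measurable
  have f: "frac r = r" if "r \<in> {0..<1}" for r :: real using that by (simp add: frac_eq)
  have f': "frac (r + 1) = frac r" for r :: real by (simp add: frac_def)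
  have half: "(\<integral>\<^sup>+s. indicator {c/2..<(c+1)/2} s * h (frac (2 * s)) \<partial>lborel) =
     ennreal (1/2) * (\<integral>\<^sup>+s. indicator {0..<1} s * h s \<partial>lborel)" if c: "c \<in> {0, 1}" for c :: real
  proof -
    have "(\<integral>\<^sup>+s. indicator {c/2..<(c+1)/2} s * h (frac (2 * s)) \<partial>lborel) =
      ennreal \<bar>1/2\<bar> * (\<integral>\<^sup>+s. indicator {c/2..<(c+1)/2} (c/2 + 1/2 * s) * h (frac (2 * (c/2 + 1/2 * s))) \<partial>lborel)"
      by (rule nn_integral_real_affine) auto
    also have "(\<integral>\<^sup>+s. indicator {c/2..<(c+1)/2} (c/2 + 1/2 * s) * h (frac (2 * (c/2 + 1/2 * s))) \<partial>lborel) =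
       (\<integral>\<^sup>+s. indicator {0..<1} s * h s \<partial>lborel)"
    proof (intro nn_integral_cong)
      fix s :: real
      have "frac (2 * (c/2 + 1/2 * s)) = frac s"
        using c f'[of s] by (auto simp: distrib_left add.commute)
      then show "indicator {c/2..<(c+1)/2} (c/2 + 1/2 * s) * h (frac (2 * (c/2 + 1/2 * s))) =
        indicator {0..<1} s * h s"
        using f[of s] by (auto simp: indicator_def field_simps)
    qed
    finally show ?thesis by simp
  qed
  have "(\<integral>\<^sup>+s. indicator {0..<1} s * h (frac (2 * s)) \<partial>lborel) =
     (\<integral>\<^sup>+s. indicator {0/2..<(0+1)/2} s * h (frac (2 * s)) + indicator {1/2..<(1+1)/2} s * h (frac (2 * s)) \<partial>lborel)"
    by (intro nn_integral_cong) (auto simp: indicator_def)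
  also have "\<dots> = (\<integral>\<^sup>+s. indicator {0/2..<(0+1)/2} s * h (frac (2 * s)) \<partial>lborel) +
      (\<integral>\<^sup>+s. indicator {1/2..<(1+1)/2} s * h (frac (2 * s)) \<partial>lborel)"
    by (intro nn_integral_add) measurable
  also have "\<dots> = ennreal (1/2) * (\<integral>\<^sup>+s. indicator {0..<1} s * h s \<partial>lborel) +
      ennreal (1/2) * (\<integral>\<^sup>+s. indicator {0..<1} s * h s \<partial>lborel)"
    by (intro arg_cong2[where f="(+)"] half) auto
  also have "\<dots> = (ennreal (1/2) + ennreal (1/2)) * (\<integral>\<^sup>+s. indicator {0..<1} s * h s \<partial>lborel)"
    by (simp only: distrib_right)
  also have "ennreal (1/2) + ennreal (1/2) = 1"
    by (subst ennreal_plus[symmetric]) auto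
  finally show ?thesis by simp
qed

context B_action
begin

text \<open>Integration over \<open>(x, s)\<close> with \<open>x\<close> distributed by \<open>\<mu>\<close> and \<open>s\<close> uniform on \<open>[0, 1)\<close>,
  independently. The point \<open>y = u (-s) x\<close> is then distributed by the smeared measure.\<close>

definition unit_expectation :: "'a measure \<Rightarrow> ('a \<Rightarrow> real \<Rightarrow> ennreal) \<Rightarrow> ennreal" where
  "unit_expectation \<mu> h = (\<integral>\<^sup>+x. \<integral>\<^sup>+s. indicator {0..<1} s * h x s \<partial>lborel \<partial>\<mu>)"

text \<open>The product measure is invariant under \<open>(x, s) \<mapsto> (a t x, frac (2 * s))\<close>. For \<open>t = ln 2\<close> the
  commutation relation turns this map, in the coordinates \<open>(y, s)\<close>, into
  \<open>y \<mapsto> a (ln 2) (u (d / 2) y)\<close> with \<open>d\<close> the first binary digit of \<open>s\<close>.\<close>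

lemma unit_expectation_invariant:
  assumes \<mu>: "borel_prob \<mu>" "a_invariant \<phi> \<mu>"
    and h: "case_prod h \<in> borel_measurable (borel \<Otimes>\<^sub>M borel)"
  shows "unit_expectation \<mu> (\<lambda>x s. h (a t x) (frac (2 * s))) = unit_expectation \<mu> h"
proof -
  interpret prob_space \<mu> using \<mu> by (simp add: borel_prob_def)
  have sm [measurable_cong]: "sets \<mu> = sets borel" using \<mu> by (simp add: borel_prob_def)
  note h [measurable]
  have "unit_expectation \<mu> (\<lambda>x s. h (a t x) (frac (2 * s))) =
      (\<integral>\<^sup>+x. \<integral>\<^sup>+s. indicator {0..<1} s * h (a t x) s \<partial>lborel \<partial>\<mu>)"
    unfolding unit_expectation_def by (subst nn_integral_doubling) auto
  also have "\<dots> = (\<integral>\<^sup>+x. \<integral>\<^sup>+s. indicator {0..<1} s * h x s \<partial>lborel \<partial>distr \<mu> borel (a t))"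
    by (subst nn_integral_distr) measurable
  also have "distr \<mu> borel (a t) = \<mu>" using \<mu> by (simp add: a_invariant_def)
  finally show ?thesis by (simp add: unit_expectation_def)
qed

text \<open>A guess for the law of the first \<open>n\<close> digits of \<open>s\<close> given \<open>y\<close>: the first digit is \<open>0\<close> with
  probability \<open>w y\<close>, and the later digits are guessed in the same way from the renormalized point
  \<open>a (ln 2) (u (d / 2) y)\<close>.\<close>

primrec digit_weight :: "('a \<Rightarrow> real) \<Rightarrow> nat \<Rightarrow> 'a \<Rightarrow> nat \<Rightarrow> real" where
  "digit_weight w 0 y j = 1"
| "digit_weight w (Suc n) y j =
    (if j < 2 ^ n then w y * digit_weight w n (a (ln 2) y) j
     else (1 - w y) * digit_weight w n (a (ln 2) (u (1/2) y)) (j - 2 ^ n))"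

lemma digit_weight_bounds:
  assumes "\<And>y. 0 < w y" "\<And>y. w y < 1"
  shows "0 < digit_weight w n y j \<and> digit_weight w n y j \<le> 1"
proof (induction n arbitrary: y j)
  case (Suc n)
  have "0 < x * z \<and> x * z \<le> 1" if "0 < x" "x < 1" "0 < z \<and> z \<le> 1" for x z :: real
    using that mult_mono[of x 1 z 1] by auto
  from this[OF assms Suc] this[OF _ _ Suc, of "1 - w y"] show ?case
    using assms[of y] by auto
qed simp

lemma digit_weight_sum: "(\<Sum>j<2^n. digit_weight w n y j) = 1"
proof (induction n arbitrary: y)
  case (Suc n)
  have "(\<Sum>j<2^Suc n. digit_weight w (Suc n) y j) =
      (\<Sum>j<2^n. digit_weight w (Suc n) y j) + (\<Sum>j=2^n..<2^n+2^n. digit_weight w (Suc n) y j)"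
    by (subst sum.union_disjoint[symmetric]) (auto intro!: sum.cong)
  also have "(\<Sum>j=2^n..<2^n+2^n. digit_weight w (Suc n) y j) =
      (\<Sum>j<2^n. (1 - w y) * digit_weight w n (a (ln 2) (u (1/2) y)) j)"
    by (rule sum.reindex_bij_witness[of _ "\<lambda>j. j + 2^n" "\<lambda>j. j - 2^n"]) auto
  finally show ?case by (simp add: sum_distrib_left[symmetric] Suc)
qed simp

lemma digit_weight_measurable [measurable]:
  assumes [measurable]: "w \<in> borel_measurable borel"
  shows "(\<lambda>y. digit_weight w n y j) \<in> borel_measurable borel"
proof (induction n arbitrary: j)
  case (Suc n)
  have m: "(\<lambda>y. digit_weight w n (f y) j) \<in> borel_measurable borel" if "f \<in> borel_measurable borel" for f j
    by (rule measurable_compose[OF that Suc])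
  show ?case by (cases "j < 2 ^ n") (auto intro!: borel_measurable_times borel_measurable_diff m)
qed simp

text \<open>The guessed probability of the first binary digit of \<open>s\<close>.\<close>

definition digit_prob :: "('a \<Rightarrow> real) \<Rightarrow> 'a \<Rightarrow> real \<Rightarrow> real" where
  "digit_prob w y s = (if s < 1/2 then w y else 1 - w y)"

lemma digit_weight_Suc_cell:
  assumes s: "s \<in> {0..<1}"
  shows "digit_weight w (Suc n) (u (-s) x) (dyadic_cell (Suc n) s) =
    digit_prob w (u (-s) x) s *
      digit_weight w n (u (- frac (2 * s)) (a (ln 2) x)) (dyadic_cell n (frac (2 * s)))"
proof -
  have l: "dyadic_cell n (frac (2 * s)) < 2 ^ n"
    by (rule dyadic_cell_less) (simp add: frac_lt_1)
  show ?thesis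
  proof (cases "s < 1/2")
    case True
    then have "frac (2 * s) = 2 * s" using s by (simp add: frac_eq)
    then have "u (- frac (2 * s)) (a (ln 2) x) = a (ln 2) (u (-s) x)" by (simp add: a_u)
    then show ?thesis using True l by (simp add: dyadic_cell_Suc[OF s] digit_prob_def del: minus_mult_right)
  next
    case False
    then have "\<lfloor>2 * s\<rfloor> = 1" using s by (intro floor_unique) auto
    then have "u (- frac (2 * s)) (a (ln 2) x) = a (ln 2) (u (1/2) (u (-s) x))"
      by (simp add: a_u u_u frac_def algebra_simps)
    then show ?thesis using False l by (simp add: dyadic_cell_Suc[OF s] digit_prob_def)
  qed
qed

lemma digit_weight_cell_measurable:
  assumes [measurable]: "w \<in> borel_measurable borel"
  shows "(\<lambda>(x, s). digit_weight w n (u (-s) x) (dyadic_cell n s)) \<in> borel_measurable (borel \<Otimes>\<^sub>M borel)"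
proof -
  have "(\<lambda>z. digit_weight w n (u (- snd z) (fst z)) (dyadic_cell n (snd z))) \<in> borel_measurable (borel \<Otimes>\<^sub>M borel)"
    by (rule measurable_compose_countable[where f="\<lambda>j z. digit_weight w n (u (- snd z) (fst z)) j" and
        g="\<lambda>z. dyadic_cell n (snd z)"]) measurable
  then show ?thesis by (simp add: split_def)
qed

text \<open>By the invariance of the product measure, the cross entropy of the guess for \<open>n\<close> digits is
  \<open>n\<close> times the cross entropy of the guess for one digit.\<close>

lemma unit_expectation_digit_weight:
  assumes \<mu>: "borel_prob \<mu>" "a_invariant \<phi> \<mu>"
    and w [measurable]: "w \<in> borel_measurable borel" and w01: "\<And>y. 0 < w y" "\<And>y. w y < 1"
  shows "unit_expectation \<mu> (\<lambda>x s. ennreal (- ln (digit_weight w n (u (-s) x) (dyadic_cell n s)))) =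
    of_nat n * unit_expectation \<mu> (\<lambda>x s. ennreal (- ln (digit_prob w (u (-s) x) s)))"
proof (induction n)
  case 0
  show ?case by (simp add: unit_expectation_def)
next
  case (Suc n)
  have sm [measurable_cong]: "sets \<mu> = sets borel" using \<mu> by (simp add: borel_prob_def)
  define I where "I = (\<lambda>x s. ennreal (- ln (digit_weight w n (u (-s) x) (dyadic_cell n s))))"
  define J where "J = (\<lambda>x s. ennreal (- ln (digit_prob w (u (-s) x) s)))"
  have Im: "case_prod I \<in> borel_measurable (borel \<Otimes>\<^sub>M borel)"
    using measurable_compose[OF digit_weight_cell_measurable[OF w, of n], of "\<lambda>r. ennreal (- ln r)" borel]
    by (simp add: I_def split_def)
  have Jm: "case_prod J \<in> borel_measurable (borel \<Otimes>\<^sub>M borel)"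
    unfolding J_def digit_prob_def by measurable
  have fm: "frac \<in> borel_measurable (borel :: real measure)" unfolding frac_def by measurable
  note [measurable] = Im Jm fm
  have dp: "0 < digit_prob w y s" "digit_prob w y s \<le> 1" for y s
    using w01[of y] by (auto simp: digit_prob_def)
  have step: "ennreal (- ln (digit_weight w (Suc n) (u (-s) x) (dyadic_cell (Suc n) s))) =
      J x s + I (a (ln 2) x) (frac (2 * s))" if "s \<in> {0..<1}" for x s
    unfolding digit_weight_Suc_cell[OF that] I_def J_def
    using dp[of "u (-s) x" s] digit_weight_bounds[where w=w, OF w01, where n=n and y="u (- frac (2 * s)) (a (ln 2) x)" and j="dyadic_cell n (frac (2 * s))"]
    by (subst ennreal_plus[symmetric]) (auto simp: ln_mult)
  have "unit_expectation \<mu> (\<lambda>x s. ennreal (- ln (digit_weight w (Suc n) (u (-s) x) (dyadic_cell (Suc n) s)))) =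
     (\<integral>\<^sup>+x. \<integral>\<^sup>+s. indicator {0..<1} s * J x s + indicator {0..<1} s * I (a (ln 2) x) (frac (2 * s)) \<partial>lborel \<partial>\<mu>)"
    unfolding unit_expectation_def
    by (intro nn_integral_cong) (auto simp: step distrib_left split: split_indicator simp del: digit_weight.simps)
  also have "\<dots> = unit_expectation \<mu> J + unit_expectation \<mu> (\<lambda>x s. I (a (ln 2) x) (frac (2 * s)))"
    unfolding unit_expectation_def
    by (simp add: nn_integral_add)
  also have "unit_expectation \<mu> (\<lambda>x s. I (a (ln 2) x) (frac (2 * s))) = unit_expectation \<mu> I"
    by (rule unit_expectation_invariant[OF \<mu> Im])
  also have "\<dots> = of_nat n * unit_expectation \<mu> J" unfolding I_def J_def by (rule Suc)
  finally show ?case by (simp add: J_def distrib_right)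
qed

end

section \<open>Conditional laws on leaves and Gibbs' inequality\<close>

definition cell_interval :: "nat \<Rightarrow> nat \<Rightarrow> real set" where
  "cell_interval n j = {real j / 2 ^ n..<(real j + 1) / 2 ^ n}"

lemma cell_interval_borel [measurable, simp]: "cell_interval n j \<in> sets borel"
  by (simp add: cell_interval_def)

lemma mem_cell_interval_iff:
  assumes "s \<in> {0..<1}"
  shows "s \<in> cell_interval n j \<longleftrightarrow> j = dyadic_cell n s"
proof -
  have "s \<in> cell_interval n j \<longleftrightarrow> real j \<le> 2 ^ n * s \<and> 2 ^ n * s < real j + 1"
    by (simp add: cell_interval_def field_simps)
  also have "\<dots> \<longleftrightarrow> \<lfloor>2 ^ n * s\<rfloor> = int j"
    by (simp add: floor_eq_iff)
  also have "\<dots> \<longleftrightarrow> j = dyadic_cell n s"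
    using assms by (auto simp: dyadic_cell_def)
  finally show ?thesis .
qed

text \<open>The leafwise measure restricted to \<open>[0, 1)\<close> and normalized. It is the zero measure when
  \<open>[0, 1)\<close> is null.\<close>

definition unit_kernel :: "('a \<Rightarrow> real measure) \<Rightarrow> 'a \<Rightarrow> real measure" where
  "unit_kernel \<nu> y = density (\<nu> y)
     (\<lambda>s. ennreal (indicator {0..<1} s) / (\<integral>\<^sup>+r. ennreal (indicator {0..<1} r) \<partial>\<nu> y))"

text \<open>The information \<open>- ln p\<close> of an event of probability \<open>p\<close>; null events carry infinite
  information.\<close>

definition information :: "ennreal \<Rightarrow> ennreal" where
  "information p = (if p = 0 then \<infinity> else ennreal (- ln (enn2real p)))"

lemma information_measurable [measurable]: "information \<in> borel_measurable borel"
  unfolding information_def by measurable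

text \<open>Integrated against the law with probabilities \<open>p\<close>, the last term contributes at most \<open>1\<close>, and
  Gibbs' inequality results. The convention at \<open>p = 0\<close> makes both sides infinite there.\<close>

lemma Gibbs_pointwise:
  assumes "p \<le> 1" "0 < r" "r \<le> 1"
  shows "information p + 1 \<le> ennreal (- ln r) + ennreal r / p"
proof (cases "p = 0")
  case True
  then show ?thesis using assms by (simp add: ennreal_divide_zero)
next
  case False
  from assms(1) have "p < \<infinity>" by (simp add: order_le_less_trans)
  then obtain q where q: "p = ennreal q" "q \<ge> 0" by (cases p) auto
  with False assms(1) have q1: "0 < q" "q \<le> 1" by (auto simp: order_less_le)
  have "ln (r / q) \<le> r / q - 1" using assms q1 by (intro ln_le_minus_one) simp
  then have "- ln q + 1 \<le> - ln r + r / q" using assms q1 by (simp add: ln_div)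
  then have "ennreal (- ln q + 1) \<le> ennreal (- ln r + r / q)" by (rule ennreal_leI)
  also have "ennreal (- ln q + 1) = ennreal (- ln q) + 1"
    using q1 by (subst ennreal_plus) auto
  also have "ennreal (- ln r + r / q) = ennreal (- ln r) + ennreal r / p"
    using q1 assms q by (subst ennreal_plus) (auto simp: divide_ennreal)
  finally show ?thesis using False q by (simp add: information_def)
qed

context
  fixes \<nu> :: "'a::topological_space \<Rightarrow> real measure"
  assumes lf: "\<And>y. locally_finite_measure (\<nu> y)"
    and ev [measurable]: "\<And>A. A \<in> sets borel \<Longrightarrow> (\<lambda>y. emeasure (\<nu> y) A) \<in> borel_measurable borel"
begin

lemma sets_nu [simp, measurable_cong]: "sets (\<nu> y) = sets borel"
  using lf by (simp add: locally_finite_measure_def)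

lemma sets_unit_kernel [simp, measurable_cong]: "sets (unit_kernel \<nu> y) = sets borel"
  by (simp add: unit_kernel_def)

lemma finite_nu_unit: "emeasure (\<nu> y) {0..<1} < \<infinity>"
proof -
  have "emeasure (\<nu> y) {0..<1} \<le> emeasure (\<nu> y) {0..1}"
    by (intro emeasure_mono) auto
  also have "\<dots> < \<infinity>" using lf by (simp add: locally_finite_measure_def)
  finally show ?thesis .
qed

lemma emeasure_unit_kernel:
  assumes [measurable]: "A \<in> sets borel"
  shows "emeasure (unit_kernel \<nu> y) A = emeasure (\<nu> y) ({0..<1} \<inter> A) / emeasure (\<nu> y) {0..<1}"
proof -
  have N: "(\<integral>\<^sup>+r. ennreal (indicator {0..<1} r) \<partial>\<nu> y) = emeasure (\<nu> y) {0..<1}"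
    by (simp add: ennreal_indicator)
  have "emeasure (unit_kernel \<nu> y) A =
      (\<integral>\<^sup>+s. indicator ({0..<1} \<inter> A) s / emeasure (\<nu> y) {0..<1} \<partial>\<nu> y)"
    unfolding unit_kernel_def N
    by (subst emeasure_density)
       (auto simp: ennreal_indicator indicator_def intro!: nn_integral_cong)
  also have "\<dots> = emeasure (\<nu> y) ({0..<1} \<inter> A) / emeasure (\<nu> y) {0..<1}"
    by (subst nn_integral_divide) auto
  finally show ?thesis .
qed

lemma subprob_unit_kernel: "subprob_space (unit_kernel \<nu> y)"
proof (rule subprob_spaceI)
  have sp: "space (unit_kernel \<nu> y) = UNIV"
    using sets_eq_imp_space_eq[OF sets_unit_kernel[of y]] by simp
  show "emeasure (unit_kernel \<nu> y) (space (unit_kernel \<nu> y)) \<le> 1"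
    unfolding sp using finite_nu_unit[of y]
    by (subst emeasure_unit_kernel, simp, cases "emeasure (\<nu> y) {0..<1} = 0") (auto simp: ennreal_divide_self)
  show "space (unit_kernel \<nu> y) \<noteq> {}" by (simp add: sp)
qed

lemma unit_kernel_measurable: "unit_kernel \<nu> \<in> borel \<rightarrow>\<^sub>M subprob_algebra borel"
  by (intro measurable_subprob_algebra subprob_unit_kernel) (auto simp: emeasure_unit_kernel)

text \<open>The likelihood ratio of nonnegative cell weights against the normalized leafwise measure
  has integral at most the total weight; cells of measure \<open>0\<close> contribute nothing, although the
  ratio may be infinite there.\<close>

lemma nn_integral_unit_kernel_cell_le:
  assumes "\<And>j. 0 \<le> r j"
  shows "(\<integral>\<^sup>+s. ennreal (r (dyadic_cell n s)) / emeasure (unit_kernel \<nu> y) (cell_interval n (dyadic_cell n s)) \<partial>unit_kernel \<nu> y)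
    \<le> ennreal (\<Sum>j<2^n. r j)"
proof -
  let ?K = "unit_kernel \<nu> y"
  have "emeasure ?K (- {0..<1}) = 0" by (subst emeasure_unit_kernel) (auto simp: Compl_eq_Diff_UNIV[symmetric])
  then have AE: "AE s in ?K. s \<in> {0..<1}"
    by (intro AE_I'[of "- {0..<1}"]) (auto simp: null_sets_def)
  have "(\<integral>\<^sup>+s. ennreal (r (dyadic_cell n s)) / emeasure ?K (cell_interval n (dyadic_cell n s)) \<partial>?K) =
     (\<integral>\<^sup>+s. (\<Sum>j<2^n. ennreal (r j) / emeasure ?K (cell_interval n j) * indicator (cell_interval n j) s) \<partial>?K)"
  proof (rule nn_integral_cong_AE, use AE in \<open>eventually_elim\<close>)
    fix s :: real assume s: "s \<in> {0..<1}"
    have "(\<Sum>j<2^n. ennreal (r j) / emeasure ?K (cell_interval n j) * indicator (cell_interval n j) s) =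
      (\<Sum>j<2^n. if j = dyadic_cell n s then ennreal (r j) / emeasure ?K (cell_interval n j) else 0)"
      by (intro sum.cong) (auto simp: mem_cell_interval_iff[OF s] indicator_def)
    then show "ennreal (r (dyadic_cell n s)) / emeasure ?K (cell_interval n (dyadic_cell n s)) =
      (\<Sum>j<2^n. ennreal (r j) / emeasure ?K (cell_interval n j) * indicator (cell_interval n j) s)"
      using dyadic_cell_less[OF s, of n] by simp
  qed
  also have "\<dots> = (\<Sum>j<2^n. ennreal (r j) / emeasure ?K (cell_interval n j) * emeasure ?K (cell_interval n j))"
    by (subst nn_integral_sum) (auto simp: nn_integral_cmult_indicator)
  also have "\<dots> \<le> (\<Sum>j<2^n. ennreal (r j))"
  proof (intro sum_mono)
    fix j
    have "emeasure ?K (cell_interval n j) < \<infinity>"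
      by (rule order_le_less_trans[OF subprob_space.subprob_emeasure_le_1[OF subprob_unit_kernel]]) simp
    then show "ennreal (r j) / emeasure ?K (cell_interval n j) * emeasure ?K (cell_interval n j) \<le> ennreal (r j)"
      by (cases "emeasure ?K (cell_interval n j) = 0") (auto simp: ennreal_divide_times ennreal_divide_self)
  qed
  also have "\<dots> = ennreal (\<Sum>j<2^n. r j)" by (rule sum_ennreal) (rule assms)
  finally show ?thesis .
qed

end

lemma borel_measurable_pair_cong:
  assumes "sets M = sets borel" "sets N = sets borel"
  shows "borel_measurable (M \<Otimes>\<^sub>M N) = borel_measurable (borel \<Otimes>\<^sub>M borel)"
  by (intro measurable_cong_sets sets_pair_measure_cong assms refl)

context B_action
begin

lemma unit_expectation_mono:
  "(\<And>x s. s \<in> {0..<1} \<Longrightarrow> f x s \<le> g x s) \<Longrightarrow> unit_expectation \<mu> f \<le> unit_expectation \<mu> g"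
  unfolding unit_expectation_def by (intro nn_integral_mono) (auto simp: indicator_def)

lemma unit_expectation_add:
  assumes sm: "sets \<mu> = sets borel"
    and f: "case_prod f \<in> borel_measurable (borel \<Otimes>\<^sub>M borel)"
    and g: "case_prod g \<in> borel_measurable (borel \<Otimes>\<^sub>M borel)"
  shows "unit_expectation \<mu> (\<lambda>x s. f x s + g x s) = unit_expectation \<mu> f + unit_expectation \<mu> g"
proof -
  have ind: "(\<lambda>(x, s). indicator {0..<1} s * h x s) \<in> borel_measurable (\<mu> \<Otimes>\<^sub>M lborel)"
    if h: "case_prod h \<in> borel_measurable (borel \<Otimes>\<^sub>M borel)" for h :: "'a \<Rightarrow> real \<Rightarrow> ennreal"
  proof -
    have "(\<lambda>z. indicator {0..<1} (snd z) * case_prod h z) \<in> borel_measurable (borel \<Otimes>\<^sub>M borel)"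
      by (intro borel_measurable_times_ennreal h measurable_compose[OF measurable_snd]) simp
    then show ?thesis
      by (subst borel_measurable_pair_cong[OF sm sets_lborel]) (simp add: split_def)
  qed
  note m = lborel.borel_measurable_nn_integral[OF ind]
  have m1: "(\<lambda>s. indicator {0..<1} s * h x s) \<in> borel_measurable lborel"
    if h: "case_prod h \<in> borel_measurable (borel \<Otimes>\<^sub>M borel)" for h :: "'a \<Rightarrow> real \<Rightarrow> ennreal" and x
  proof -
    have "h x \<in> borel_measurable borel"
      using measurable_compose[OF measurable_Pair1' h, of x] by simp
    then show "(\<lambda>s. indicator {0..<1} s * h x s) \<in> borel_measurable lborel"
      by (intro borel_measurable_times_ennreal) auto
  qed
  show ?thesis
    unfolding unit_expectation_def distrib_left
    by (simp only: nn_integral_add[OF m1[OF f] m1[OF g]] nn_integral_add[OF m[OF f] m[OF g]])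
qed

lemma unit_expectation_one: "prob_space \<mu> \<Longrightarrow> unit_expectation \<mu> (\<lambda>x s. 1) = 1"
  unfolding unit_expectation_def by (simp add: prob_space.emeasure_space_1)

lemma u_smear_kernel_measurable:
  assumes "borel_prob \<mu>"
  shows "(\<lambda>s. distr \<mu> borel (u (- s))) \<in> density lborel (\<lambda>s. ennreal (f s)) \<rightarrow>\<^sub>M subprob_algebra borel"
proof -
  interpret prob_space \<mu> using assms by (simp add: borel_prob_def)
  have sm [measurable_cong]: "sets \<mu> = sets borel" using assms by (simp add: borel_prob_def)
  have "\<mu> \<in> space (subprob_algebra \<mu>)"
    by (auto simp: space_subprob_algebra intro: prob_space_imp_subprob_space prob_space_axioms)
  then have c: "(\<lambda>_. \<mu>) \<in> density lborel (\<lambda>s. ennreal (f s)) \<rightarrow>\<^sub>M subprob_algebra \<mu>" by simp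
  have "case_prod (\<lambda>s. u (- s)) \<in> borel_measurable (density lborel (\<lambda>s. ennreal (f s)) \<Otimes>\<^sub>M \<mu>)"
    by (subst borel_measurable_pair_cong[OF _ sm]) (simp_all add: split_def)
  then show ?thesis by (rule measurable_distr2[OF _ c])
qed

lemma prob_density_unit: "prob_density (indicator {0..<1})"
  by (simp add: prob_density_def)

lemma prob_space_unit: "prob_space (density lborel (\<lambda>s::real. ennreal (indicator {0..<1} s)))"
  by (rule prob_spaceI) (subst emeasure_density, auto simp: ennreal_indicator)

lemma u_smear_subprob:
  assumes "borel_prob \<mu>"
  shows "subprob_space (u_smear \<phi> (indicator {0..<1}) \<mu>)"
  unfolding u_smear_def
  by (rule subprob_space_bind[OF _ u_smear_kernel_measurable[OF assms]])
     (intro prob_space_imp_subprob_space prob_space_unit)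

lemma sets_u_smear:
  assumes "borel_prob \<mu>"
  shows "sets (u_smear \<phi> (indicator {0..<1}) \<mu>) = sets borel"
  unfolding u_smear_def by (subst sets_bind) auto

text \<open>The defining property of the leafwise measures for the uniform density on \<open>[0, 1)\<close>: given
  \<open>y = u (-s) x\<close>, the conditional law of \<open>s\<close> is \<^term>\<open>unit_kernel \<nu> y\<close>.\<close>

lemma leafwise_disintegration:
  assumes \<mu>: "borel_prob \<mu>" and \<nu>: "leafwise_measures \<phi> \<mu> \<nu>"
    and h: "case_prod h \<in> borel_measurable (borel \<Otimes>\<^sub>M borel)"
  shows "unit_expectation \<mu> (\<lambda>x s. h (u (-s) x) s) =
    (\<integral>\<^sup>+y. \<integral>\<^sup>+s. h y s \<partial>unit_kernel \<nu> y \<partial>u_smear \<phi> (indicator {0..<1}) \<mu>)"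
proof -
  have sm [measurable_cong]: "sets \<mu> = sets borel" using \<mu> by (simp add: borel_prob_def)
  note h [measurable]
  have lf: "\<And>y. locally_finite_measure (\<nu> y)"
    and ev: "\<And>A. A \<in> sets borel \<Longrightarrow> (\<lambda>y. emeasure (\<nu> y) A) \<in> borel_measurable borel"
    using \<nu> by (auto simp: leafwise_measures_def)
  let ?D = "density lborel (\<lambda>s::real. ennreal (indicator {0..<1} s))"
  let ?S = "u_smear \<phi> (indicator {0..<1}) \<mu>"
  interpret D: prob_space ?D by (rule prob_space_unit)
  have eq: "distr (\<mu> \<Otimes>\<^sub>M ?D) (borel \<Otimes>\<^sub>M borel) (\<lambda>(x, s). (u (- s) x, s)) =
      ?S \<bind> (\<lambda>y. return borel y \<Otimes>\<^sub>M unit_kernel \<nu> y)"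
    using \<nu> prob_density_unit unfolding leafwise_measures_def unit_kernel_def by blast
  have "unit_expectation \<mu> (\<lambda>x s. h (u (-s) x) s) = (\<integral>\<^sup>+x. \<integral>\<^sup>+s. h (u (-s) x) s \<partial>?D \<partial>\<mu>)"
    unfolding unit_expectation_def
    by (subst nn_integral_density) (auto simp: ennreal_indicator)
  also have "\<dots> = (\<integral>\<^sup>+z. case_prod (\<lambda>x s. h (u (-s) x) s) z \<partial>(\<mu> \<Otimes>\<^sub>M ?D))"
    by (subst D.nn_integral_fst[symmetric], subst borel_measurable_pair_cong[OF sm])
       (simp_all add: split_def)
  also have "\<dots> = (\<integral>\<^sup>+z. case_prod h z \<partial>distr (\<mu> \<Otimes>\<^sub>M ?D) (borel \<Otimes>\<^sub>M borel) (\<lambda>(x, s). (u (- s) x, s)))"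
  proof -
    have "(\<lambda>(x, s). (u (- s) x, s)) \<in> borel \<Otimes>\<^sub>M borel \<rightarrow>\<^sub>M borel \<Otimes>\<^sub>M borel"
      by (simp add: split_def)
    then have "(\<lambda>(x, s). (u (- s) x, s)) \<in> \<mu> \<Otimes>\<^sub>M ?D \<rightarrow>\<^sub>M borel \<Otimes>\<^sub>M borel"
      by (subst measurable_cong_sets[OF sets_pair_measure_cong[OF sm, of ?D borel] refl]) simp_all
    from nn_integral_distr[OF this, of "case_prod h"] h show ?thesis by (simp add: split_def)
  qed
  also have "\<dots> = (\<integral>\<^sup>+y. \<integral>\<^sup>+z. case_prod h z \<partial>(return borel y \<Otimes>\<^sub>M unit_kernel \<nu> y) \<partial>?S)"
    unfolding eq
  proof (rule nn_integral_bind[OF h])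
    have "(\<lambda>y. return borel y \<Otimes>\<^sub>M unit_kernel \<nu> y) \<in> borel \<rightarrow>\<^sub>M subprob_algebra (borel \<Otimes>\<^sub>M borel)"
      by (intro measurable_pair_measure return_measurable unit_kernel_measurable lf ev)
    then show "(\<lambda>y. return borel y \<Otimes>\<^sub>M unit_kernel \<nu> y) \<in> ?S \<rightarrow>\<^sub>M subprob_algebra (borel \<Otimes>\<^sub>M borel)"
      by (simp only: measurable_cong_sets[OF sets_u_smear[OF \<mu>] refl])
  qed
  also have "\<dots> = (\<integral>\<^sup>+y. \<integral>\<^sup>+s. h y s \<partial>unit_kernel \<nu> y \<partial>?S)"
  proof (intro nn_integral_cong)
    fix y
    interpret K: subprob_space "unit_kernel \<nu> y" by (rule subprob_unit_kernel[OF lf ev])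
    have sk [measurable_cong]: "sets (unit_kernel \<nu> y) = sets borel" by (rule sets_unit_kernel[OF lf ev])
    have "(\<integral>\<^sup>+z. case_prod h z \<partial>(return borel y \<Otimes>\<^sub>M unit_kernel \<nu> y)) =
       (\<integral>\<^sup>+y'. \<integral>\<^sup>+s. h y' s \<partial>unit_kernel \<nu> y \<partial>return borel y)"
      by (subst K.nn_integral_fst[symmetric], subst borel_measurable_pair_cong[OF sets_return sk])
         (simp_all add: h)
    also have "\<dots> = (\<integral>\<^sup>+s. h y s \<partial>unit_kernel \<nu> y)"
    proof (rule nn_integral_return)
      have "case_prod h \<in> borel_measurable (borel \<Otimes>\<^sub>M unit_kernel \<nu> y)"
        by (subst borel_measurable_pair_cong[OF refl sk]) (rule h)
      then show "(\<lambda>y'. \<integral>\<^sup>+s. h y' s \<partial>unit_kernel \<nu> y) \<in> borel_measurable borel"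
        by (rule K.borel_measurable_nn_integral)
    qed simp
    finally show "(\<integral>\<^sup>+z. case_prod h z \<partial>(return borel y \<Otimes>\<^sub>M unit_kernel \<nu> y)) = (\<integral>\<^sup>+s. h y s \<partial>unit_kernel \<nu> y)" .
  qed
  finally show ?thesis .
qed

text \<open>The conditional probability, given \<open>y\<close>, of the dyadic interval of level \<open>n\<close> around \<open>s\<close>.\<close>

definition cell_prob :: "('a \<Rightarrow> real measure) \<Rightarrow> nat \<Rightarrow> 'a \<Rightarrow> real \<Rightarrow> ennreal" where
  "cell_prob \<nu> n y s = emeasure (unit_kernel \<nu> y) (cell_interval n (dyadic_cell n s))"

text \<open>Gibbs' inequality: the conditional entropy of the first \<open>n\<close> digits given \<open>y\<close> is at most the
  cross entropy of any guess. The second part records the measurability of the integrand.\<close>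

lemma conditional_entropy_le:
  assumes \<mu>: "borel_prob \<mu>" "a_invariant \<phi> \<mu>" and \<nu>: "leafwise_measures \<phi> \<mu> \<nu>"
    and w [measurable]: "w \<in> borel_measurable borel" and w01: "\<And>y. 0 < w y" "\<And>y. w y < 1"
  shows "unit_expectation \<mu> (\<lambda>x s. information (cell_prob \<nu> n (u (-s) x) s)) \<le>
    of_nat n * unit_expectation \<mu> (\<lambda>x s. ennreal (- ln (digit_prob w (u (-s) x) s)))"
    and "(\<lambda>(x, s). information (cell_prob \<nu> n (u (-s) x) s)) \<in> borel_measurable (borel \<Otimes>\<^sub>M borel)"
proof -
  interpret prob_space \<mu> using \<mu> by (simp add: borel_prob_def)
  have sm [measurable_cong]: "sets \<mu> = sets borel" using \<mu> by (simp add: borel_prob_def)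
  have lf: "\<And>y. locally_finite_measure (\<nu> y)"
    and ev: "\<And>A. A \<in> sets borel \<Longrightarrow> (\<lambda>y. emeasure (\<nu> y) A) \<in> borel_measurable borel"
    using \<nu> by (auto simp: leafwise_measures_def)
  define r where "r = (\<lambda>y s. ennreal (digit_weight w n y (dyadic_cell n s)))"
  have [measurable]: "(\<lambda>y. emeasure (unit_kernel \<nu> y) A) \<in> borel_measurable borel" if "A \<in> sets borel" for A
    by (rule measurable_emeasure_kernel[OF unit_kernel_measurable[OF lf ev] that])
  have pm: "case_prod (cell_prob \<nu> n) \<in> borel_measurable (borel \<Otimes>\<^sub>M borel)"
    unfolding cell_prob_def split_def
    by (rule measurable_compose_countable[where f="\<lambda>j z. emeasure (unit_kernel \<nu> (fst z)) (cell_interval n j)"]) measurable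
  have rm: "case_prod r \<in> borel_measurable (borel \<Otimes>\<^sub>M borel)"
    unfolding r_def split_def
    by (rule measurable_compose_countable[where f="\<lambda>j z. ennreal (digit_weight w n (fst z) j)"]) measurable
  note [measurable] = pm rm
  have lm: "(\<lambda>(x, s). ennreal (- ln (digit_weight w n (u (-s) x) (dyadic_cell n s)))) \<in> borel_measurable (borel \<Otimes>\<^sub>M borel)"
    using measurable_compose[OF digit_weight_cell_measurable[OF w, of n], of "\<lambda>r. ennreal (- ln r)" borel]
    by (simp add: split_def)
  show im: "(\<lambda>(x, s). information (cell_prob \<nu> n (u (-s) x) s)) \<in> borel_measurable (borel \<Otimes>\<^sub>M borel)"
    by measurable
  have "unit_expectation \<mu> (\<lambda>x s. r (u (-s) x) s / cell_prob \<nu> n (u (-s) x) s) =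
      (\<integral>\<^sup>+y. \<integral>\<^sup>+s. r y s / cell_prob \<nu> n y s \<partial>unit_kernel \<nu> y \<partial>u_smear \<phi> (indicator {0..<1}) \<mu>)"
    by (rule leafwise_disintegration[OF \<mu>(1) \<nu>]) measurable
  also have "\<dots> \<le> (\<integral>\<^sup>+y. 1 \<partial>u_smear \<phi> (indicator {0..<1}) \<mu>)"
    unfolding r_def cell_prob_def
    using nn_integral_unit_kernel_cell_le[OF lf ev, where n=n and r="digit_weight w n y" and y=y for y]
      digit_weight_bounds[OF w01]
    by (intro nn_integral_mono) (simp add: digit_weight_sum less_imp_le)
  also have "\<dots> \<le> 1"
    using subprob_space.emeasure_space_le_1[OF u_smear_subprob[OF \<mu>(1)]] by simp
  finally have ratio: "unit_expectation \<mu> (\<lambda>x s. r (u (-s) x) s / cell_prob \<nu> n (u (-s) x) s) \<le> 1" .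
  have "1 + unit_expectation \<mu> (\<lambda>x s. information (cell_prob \<nu> n (u (-s) x) s)) =
      unit_expectation \<mu> (\<lambda>x s. information (cell_prob \<nu> n (u (-s) x) s) + 1)"
    using im by (subst unit_expectation_add) (auto simp: unit_expectation_one[OF prob_space_axioms] sm add.commute)
  also have "\<dots> \<le> unit_expectation \<mu> (\<lambda>x s. ennreal (- ln (digit_weight w n (u (-s) x) (dyadic_cell n s))) +
      r (u (-s) x) s / cell_prob \<nu> n (u (-s) x) s)"
    unfolding r_def cell_prob_def
    using digit_weight_bounds[OF w01]
    by (intro unit_expectation_mono Gibbs_pointwise subprob_space.subprob_emeasure_le_1 subprob_unit_kernel[OF lf ev]) auto
  also have "\<dots> = unit_expectation \<mu> (\<lambda>x s. ennreal (- ln (digit_weight w n (u (-s) x) (dyadic_cell n s)))) +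
      unit_expectation \<mu> (\<lambda>x s. r (u (-s) x) s / cell_prob \<nu> n (u (-s) x) s)"
    using lm by (intro unit_expectation_add sm) measurable
  also have "\<dots> \<le> unit_expectation \<mu> (\<lambda>x s. ennreal (- ln (digit_weight w n (u (-s) x) (dyadic_cell n s)))) + 1"
    by (intro add_left_mono ratio)
  also have "\<dots> = 1 + of_nat n * unit_expectation \<mu> (\<lambda>x s. ennreal (- ln (digit_prob w (u (-s) x) s)))"
    by (subst unit_expectation_digit_weight[OF \<mu> w w01]) (simp add: add.commute)
  finally show "unit_expectation \<mu> (\<lambda>x s. information (cell_prob \<nu> n (u (-s) x) s)) \<le>
    of_nat n * unit_expectation \<mu> (\<lambda>x s. ennreal (- ln (digit_prob w (u (-s) x) s)))"
    by (simp add: ennreal_add_left_cancel_le)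
qed

end

section \<open>Leafwise dimension as a lower bound for entropy\<close>

lemma information_ge:
  assumes "p \<le> ennreal q" "0 < q"
  shows "ennreal (- ln q) \<le> information p"
proof (cases "p = 0")
  case False
  have "p < \<infinity>" using assms(1) by (simp add: order_le_less_trans)
  then obtain r where r: "p = ennreal r" "r \<ge> 0" by (cases p) auto
  with False assms have "0 < r" "r \<le> q" by (auto simp: order_less_le)
  then show ?thesis using r by (auto simp: information_def intro!: ennreal_leI)
qed (simp add: information_def)

context B_action
begin

abbreviation unit_uniform :: "real measure" where
  "unit_uniform \<equiv> density lborel (\<lambda>s. ennreal (indicator {0..<1} s))"

lemma unit_expectation_eq_nn_integral:
  assumes sm: "sets \<mu> = sets borel"
    and h: "case_prod h \<in> borel_measurable (borel \<Otimes>\<^sub>M borel)"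
  shows "unit_expectation \<mu> h = (\<integral>\<^sup>+z. case_prod h z \<partial>(\<mu> \<Otimes>\<^sub>M unit_uniform))"
proof -
  interpret D: prob_space unit_uniform by (rule prob_space_unit)
  have hx: "h x \<in> borel_measurable borel" for x
    using measurable_compose[OF measurable_Pair1' h, of x] by simp
  have "unit_expectation \<mu> h = (\<integral>\<^sup>+x. \<integral>\<^sup>+s. h x s \<partial>unit_uniform \<partial>\<mu>)"
    unfolding unit_expectation_def
    by (subst nn_integral_density) (auto simp: ennreal_indicator hx)
  also have "\<dots> = (\<integral>\<^sup>+z. case_prod h z \<partial>(\<mu> \<Otimes>\<^sub>M unit_uniform))"
    by (subst D.nn_integral_fst[symmetric], subst borel_measurable_pair_cong[OF sm])
       (simp_all add: h)
  finally show ?thesis .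
qed

lemma unit_expectation_liminf:
  assumes sm: "sets \<mu> = sets borel"
    and h: "\<And>n. case_prod (h n) \<in> borel_measurable (borel \<Otimes>\<^sub>M borel)"
  shows "unit_expectation \<mu> (\<lambda>x s. liminf (\<lambda>n. h n x s)) \<le> liminf (\<lambda>n. unit_expectation \<mu> (h n))"
proof -
  have m: "(\<lambda>(x, s). liminf (\<lambda>n. h n x s)) \<in> borel_measurable (borel \<Otimes>\<^sub>M borel)"
    unfolding split_def by (rule borel_measurable_liminf) (use h in \<open>simp add: split_def\<close>)
  have "(\<integral>\<^sup>+z. liminf (\<lambda>n. case_prod (h n) z) \<partial>(\<mu> \<Otimes>\<^sub>M unit_uniform))
      \<le> liminf (\<lambda>n. (\<integral>\<^sup>+z. case_prod (h n) z \<partial>(\<mu> \<Otimes>\<^sub>M unit_uniform)))"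
    by (rule nn_integral_liminf) (subst borel_measurable_pair_cong[OF sm], simp_all add: h)
  then show ?thesis
    by (simp add: unit_expectation_eq_nn_integral[OF sm m] unit_expectation_eq_nn_integral[OF sm h] split_def)
qed

lemma unit_expectation_divide:
  assumes sm: "sets \<mu> = sets borel"
    and h: "case_prod h \<in> borel_measurable (borel \<Otimes>\<^sub>M borel)"
  shows "unit_expectation \<mu> (\<lambda>x s. h x s / c) = unit_expectation \<mu> h / c"
proof -
  have m: "(\<lambda>(x, s). h x s / c) \<in> borel_measurable (borel \<Otimes>\<^sub>M borel)"
    using h by (simp add: split_def borel_measurable_divide_ennreal)
  have "case_prod h \<in> borel_measurable (\<mu> \<Otimes>\<^sub>M unit_uniform)"
    by (subst borel_measurable_pair_cong[OF sm]) (simp_all add: h)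
  from nn_integral_divide[OF this, of c] show ?thesis
    unfolding unit_expectation_eq_nn_integral[OF sm m] unit_expectation_eq_nn_integral[OF sm h]
    by (simp add: split_def)
qed

text \<open>The dyadic interval of level \<open>n\<close> around \<open>s\<close>, seen from \<open>x = u s y\<close>, lies in
  \<open>[-2^(-n), 2^(-n)]\<close>. Since the leafwise measure at \<open>y\<close> is proportional to a translate of the
  leafwise measure at \<open>x\<close>, the information of this interval grows at least like \<open>n * \<delta> * ln 2\<close>.\<close>

lemma liminf_information_ge:
  assumes \<nu>: "leafwise_measures \<phi> \<mu> \<nu>"
    and pos: "\<And>t. 0 < measure (\<nu> x) {- exp (- t)..exp (- t)}"
    and lim: "((\<lambda>t. 1 / t * ln (measure (\<nu> x) {- exp (- t)..exp (- t)})) \<longlongrightarrow> - \<delta>) at_top"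
    and s: "s \<in> {0..<1}"
  shows "ennreal (\<delta> * ln 2) \<le>
    liminf (\<lambda>n. information (cell_prob \<nu> (Suc n) (u (-s) x) s) / of_nat (Suc n))"
proof -
  have lf: "\<And>y. locally_finite_measure (\<nu> y)"
    and ev: "\<And>A. A \<in> sets borel \<Longrightarrow> (\<lambda>y. emeasure (\<nu> y) A) \<in> borel_measurable borel"
    using \<nu> by (auto simp: leafwise_measures_def)
  have sn [measurable_cong, simp]: "sets (\<nu> y) = sets borel" for y
    using lf by (simp add: locally_finite_measure_def)
  let ?y = "u (-s) x"
  define m where "m t = measure (\<nu> x) {- exp (- t)..exp (- t)}" for t
  have em: "emeasure (\<nu> x) {- exp (- t)..exp (- t)} = ennreal (m t)" for t
    unfolding m_def using lf[of x]
    by (intro emeasure_eq_ennreal_measure) (auto simp: locally_finite_measure_def less_top)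
  obtain c where c: "c > 0" "\<nu> ?y = scale_measure (ennreal c) (distr (\<nu> x) borel (\<lambda>r. r - (-s)))"
    using \<nu> unfolding leafwise_measures_def by blast
  define N where "N = emeasure (\<nu> ?y) {0..<1}"
  have cell: "emeasure (\<nu> ?y) (cell_interval n (dyadic_cell n s)) \<le> ennreal (c * m (real n * ln 2))" for n
  proof -
    have e: "exp (- (real n * ln 2)) = 1 / 2 ^ n"
      by (simp add: exp_minus exp_of_nat_mult field_simps)
    have "emeasure (\<nu> ?y) (cell_interval n (dyadic_cell n s)) =
        ennreal c * emeasure (\<nu> x) ((\<lambda>r. r + s) -` cell_interval n (dyadic_cell n s))"
    proof -
      have "(\<lambda>r. r + s) \<in> \<nu> x \<rightarrow>\<^sub>M borel"
        by (simp add: measurable_cong_sets[OF sn refl])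
      then have "emeasure (distr (\<nu> x) borel (\<lambda>r. r + s)) (cell_interval n (dyadic_cell n s)) =
          emeasure (\<nu> x) ((\<lambda>r. r + s) -` cell_interval n (dyadic_cell n s))"
        using sets_eq_imp_space_eq[OF sn[of x]] by (simp add: emeasure_distr)
      then show ?thesis unfolding c(2) by simp
    qed
    also have "(\<lambda>r. r + s) -` cell_interval n (dyadic_cell n s) \<subseteq> {- (1 / 2 ^ n)..1 / 2 ^ n}"
      using mem_cell_interval_iff[OF s, of n "dyadic_cell n s"]
      by (auto simp: cell_interval_def add_divide_distrib)
    then have "ennreal c * emeasure (\<nu> x) ((\<lambda>r. r + s) -` cell_interval n (dyadic_cell n s))
        \<le> ennreal c * emeasure (\<nu> x) {- (1 / 2 ^ n)..1 / 2 ^ n}"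
      by (intro mult_left_mono emeasure_mono) auto
    also have "\<dots> = ennreal (c * m (real n * ln 2))"
      using em[of "real n * ln 2"] c(1) by (simp add: e ennreal_mult')
    finally show ?thesis .
  qed
  define b where "b n = (- ln (c / enn2real N) - ln (m (real (Suc n) * ln 2))) / real (Suc n)" for n
  have le: "ennreal (b n) \<le> information (cell_prob \<nu> (Suc n) ?y s) / of_nat (Suc n)" for n
  proof -
    let ?I = "cell_interval (Suc n) (dyadic_cell (Suc n) s)"
    have p: "cell_prob \<nu> (Suc n) ?y s = emeasure (\<nu> ?y) ({0..<1} \<inter> ?I) / N"
      unfolding cell_prob_def N_def by (rule emeasure_unit_kernel[OF lf ev]) auto
    show ?thesis
    proof (cases "N = 0")
      case True
      \<comment> \<open>Here the conditional probability is \<open>0 / 0 = 0\<close>, so the information is infinite.\<close>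
      then have "emeasure (\<nu> ?y) ({0..<1} \<inter> ?I) = 0"
        unfolding N_def by (rule emeasure_eq_0[OF _ _ Int_lower1, rotated]) simp
      then show ?thesis by (simp add: p information_def ennreal_top_divide)
    next
      case False
      have "N < \<infinity>" unfolding N_def by (rule finite_nu_unit[OF lf ev])
      then obtain N' where N': "N = ennreal N'" "N' > 0"
        using False by (cases N) (auto simp: order_less_le)
      have "cell_prob \<nu> (Suc n) ?y s \<le> emeasure (\<nu> ?y) ?I / N"
        unfolding p by (intro divide_right_mono_ennreal emeasure_mono) auto
      also have "\<dots> \<le> ennreal (c * m (real (Suc n) * ln 2)) / N"
        by (intro divide_right_mono_ennreal cell)
      also have "\<dots> = ennreal (c / N' * m (real (Suc n) * ln 2))"
        using N' c(1) pos unfolding m_def by (simp add: divide_ennreal less_imp_le)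
      finally have "ennreal (- ln (c / N' * m (real (Suc n) * ln 2))) \<le> information (cell_prob \<nu> (Suc n) ?y s)"
        using N' c(1) pos unfolding m_def by (intro information_ge) auto
      also have "- ln (c / N' * m (real (Suc n) * ln 2)) = b n * real (Suc n)"
      proof -
        have "ln (c / N' * m (real (Suc n) * ln 2)) = ln (c / N') + ln (m (real (Suc n) * ln 2))"
          using N' c(1) pos unfolding m_def by (intro ln_mult_pos) auto
        then show ?thesis using N' by (simp add: b_def del: of_nat_Suc)
      qed
      finally have "ennreal (b n * real (Suc n)) / of_nat (Suc n)
          \<le> information (cell_prob \<nu> (Suc n) ?y s) / of_nat (Suc n)"
        by (rule divide_right_mono_ennreal)
      moreover have "ennreal (b n * real (Suc n)) / of_nat (Suc n) = ennreal (b n)"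
        by (cases "b n \<ge> 0")
           (simp_all add: ennreal_of_nat_eq_real_of_nat divide_ennreal ennreal_neg mult_nonpos_nonneg del: of_nat_Suc)
      ultimately show ?thesis by simp
    qed
  qed
  have "(\<lambda>n. - ln (c / enn2real N) * inverse (real (Suc n)) -
        ln 2 * (1 / (real (Suc n) * ln 2) * ln (m (real (Suc n) * ln 2)))) \<longlonglongrightarrow>
      - ln (c / enn2real N) * 0 - ln 2 * (- \<delta>)"
  proof (intro tendsto_intros LIMSEQ_inverse_real_of_nat)
    have "filterlim (\<lambda>n. real (Suc n) * ln 2) at_top sequentially"
      by (intro filterlim_at_top_mult_tendsto_pos[OF tendsto_const])
         (auto intro!: filterlim_compose[OF filterlim_real_sequentially filterlim_Suc] simp del: of_nat_Suc)
    then show "(\<lambda>n. 1 / (real (Suc n) * ln 2) * ln (m (real (Suc n) * ln 2))) \<longlonglongrightarrow> - \<delta>"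
      unfolding m_def by (rule filterlim_compose[OF lim])
  qed
  moreover have "C * inverse r - ln 2 * (1 / (r * ln 2) * D) = (C - D) / r" if "r > 0" for C D r :: real
    using that by (simp add: field_simps)
  then have "- ln (c / enn2real N) * inverse (real (Suc n)) -
      ln 2 * (1 / (real (Suc n) * ln 2) * ln (m (real (Suc n) * ln 2))) = b n" for n
    unfolding b_def by (metis of_nat_0_less_iff zero_less_Suc)
  ultimately have "b \<longlonglongrightarrow> \<delta> * ln 2"
    by (simp only: mult_zero_right mult_minus_right diff_0 minus_minus mult.commute[of "ln 2" \<delta>])
  then have "(\<lambda>n. ennreal (b n)) \<longlonglongrightarrow> ennreal (\<delta> * ln 2)" by (rule tendsto_ennrealI)
  then have "ennreal (\<delta> * ln 2) = liminf (\<lambda>n. ennreal (b n))"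
    by (simp add: lim_imp_Liminf)
  also have "\<dots> \<le> liminf (\<lambda>n. information (cell_prob \<nu> (Suc n) ?y s) / of_nat (Suc n))"
    by (intro Liminf_mono always_eventually allI le)
  finally show ?thesis .
qed

text \<open>The key inequality: by Fatou's lemma the dimension bounds the conditional entropy per digit
  from below, hence also the cross entropy of every guess for the first digit.\<close>

lemma leafwise_dim_le_cross_entropy:
  assumes \<mu>: "borel_prob \<mu>" "a_invariant \<phi> \<mu>" and dim: "has_leafwise_dim \<phi> \<mu> \<delta>"
    and w: "w \<in> borel_measurable borel" "\<And>y. 0 < w y" "\<And>y. w y < 1"
  shows "ennreal (\<delta> * ln 2) \<le> unit_expectation \<mu> (\<lambda>x s. ennreal (- ln (digit_prob w (u (-s) x) s)))"
    (is "_ \<le> ?H")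
proof -
  interpret prob_space \<mu> using \<mu> by (simp add: borel_prob_def)
  have sm: "sets \<mu> = sets borel" using \<mu> by (simp add: borel_prob_def)
  obtain \<nu> where \<nu>: "leafwise_measures \<phi> \<mu> \<nu>"
    and AE: "AE x in \<mu>. (\<forall>t. 0 < measure (\<nu> x) {- exp (- t)..exp (- t)}) \<and>
           ((\<lambda>t. 1 / t * ln (measure (\<nu> x) {- exp (- t)..exp (- t)})) \<longlongrightarrow> - \<delta>) at_top"
    using dim unfolding has_leafwise_dim_def by blast
  define L where "L n = (\<lambda>x s. information (cell_prob \<nu> (Suc n) (u (-s) x) s))" for n
  have Lm: "case_prod (L n) \<in> borel_measurable (borel \<Otimes>\<^sub>M borel)" for n
    unfolding L_def by (rule conditional_entropy_le(2)[OF \<mu> \<nu> w])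
  have Lm': "case_prod (\<lambda>x s. L n x s / of_nat (Suc n)) \<in> borel_measurable (borel \<Otimes>\<^sub>M borel)" for n
    using Lm[of n] by (simp add: split_def borel_measurable_divide_ennreal del: of_nat_Suc)
  have "ennreal (\<delta> * ln 2) = (\<integral>\<^sup>+x. \<integral>\<^sup>+s. indicator {0..<1::real} s * ennreal (\<delta> * ln 2) \<partial>lborel \<partial>\<mu>)"
  proof -
    have "(\<integral>\<^sup>+s. indicator {0..<1::real} s * ennreal (\<delta> * ln 2) \<partial>lborel) = ennreal (\<delta> * ln 2)"
      by (subst nn_integral_multc) auto
    then show ?thesis by (simp only: nn_integral_const emeasure_space_1 mult_1_right)
  qed
  also have "\<dots> \<le> unit_expectation \<mu> (\<lambda>x s. liminf (\<lambda>n. L n x s / of_nat (Suc n)))"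
    unfolding unit_expectation_def
  proof (rule nn_integral_mono_AE, use AE in \<open>eventually_elim\<close>)
    fix x assume x: "(\<forall>t. 0 < measure (\<nu> x) {- exp (- t)..exp (- t)}) \<and>
           ((\<lambda>t. 1 / t * ln (measure (\<nu> x) {- exp (- t)..exp (- t)})) \<longlongrightarrow> - \<delta>) at_top"
    show "(\<integral>\<^sup>+s. indicator {0..<1::real} s * ennreal (\<delta> * ln 2) \<partial>lborel) \<le>
       (\<integral>\<^sup>+s. indicator {0..<1} s * liminf (\<lambda>n. L n x s / of_nat (Suc n)) \<partial>lborel)"
    proof (rule nn_integral_mono)
      fix s :: real
      show "indicator {0..<1} s * ennreal (\<delta> * ln 2) \<le> indicator {0..<1} s * liminf (\<lambda>n. L n x s / of_nat (Suc n))"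
        using liminf_information_ge[OF \<nu>, of x \<delta> s] x
        by (cases "s \<in> {0..<1}") (auto simp: L_def simp del: of_nat_Suc)
    qed
  qed
  also have "\<dots> \<le> liminf (\<lambda>n. unit_expectation \<mu> (\<lambda>x s. L n x s / of_nat (Suc n)))"
    by (rule unit_expectation_liminf[OF sm Lm'])
  also have "\<dots> \<le> liminf (\<lambda>n. ?H)"
  proof (intro Liminf_mono always_eventually allI)
    fix n
    have "unit_expectation \<mu> (\<lambda>x s. L n x s / of_nat (Suc n)) = unit_expectation \<mu> (L n) / of_nat (Suc n)"
      by (rule unit_expectation_divide[OF sm Lm])
    also have "\<dots> \<le> of_nat (Suc n) * ?H / of_nat (Suc n)"
      unfolding L_def by (intro divide_right_mono_ennreal conditional_entropy_le(1)[OF \<mu> \<nu> w])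
    also have "\<dots> = ?H"
      by (subst mult.commute, rule mult_divide_eq_ennreal) (auto simp del: of_nat_Suc simp: ennreal_of_nat_eq_real_of_nat)
    finally show "unit_expectation \<mu> (\<lambda>x s. L n x s / of_nat (Suc n)) \<le> ?H" .
  qed
  also have "\<dots> = ?H" by (simp add: Liminf_const)
  finally show ?thesis .
qed

end

section \<open>Averages over the halves of an interval\<close>

text \<open>If the averages over \<open>[0, L / 2]\<close> and \<open>[L / 2, L]\<close> agree for all \<open>L\<close>, differentiation in \<open>L\<close>
  gives \<open>G L = G (L / 2)\<close>, and iterating this leads to \<open>G 0\<close>.\<close>

lemma average_halves_imp_constant:
  fixes G :: "real \<Rightarrow> real"
  assumes cont: "continuous_on UNIV G"
    and eq: "\<And>L. L > 0 \<Longrightarrow>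
      integral {0..1/2} (\<lambda>s. G (L * s)) = integral {1/2..1} (\<lambda>s. G (L * s))"
    and T: "T \<ge> 0"
  shows "G T = G 0"
proof -
  obtain H where H: "\<And>t. t \<in> {0..T + 1} \<Longrightarrow> (H has_real_derivative G t) (at t within {0..T + 1})"
    using antiderivative_continuous[of 0 "T + 1" G] cont T
    by (auto simp: has_real_derivative_iff_has_vector_derivative intro: continuous_on_subset)
  have der: "(H has_real_derivative G t) (at t)" if "0 < t" "t < T + 1" for t
    using H[of t] that by (simp add: at_within_Icc_at)
  have int: "integral {p..q} (\<lambda>s. G (L * s)) = (H (L * q) - H (L * p)) / L"
    if "0 < L" "L \<le> T + 1" "0 \<le> p" "p \<le> q" "q \<le> 1" for L p q
  proof (rule integral_unique)
    have "((\<lambda>s. G (L * s)) has_integral (H (L * q) / L - H (L * p) / L)) {p..q}"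
    proof (rule fundamental_theorem_of_calculus)
      fix s assume s: "s \<in> {p..q}"
      have sub: "(\<lambda>s. L * s) ` {p..q} \<subseteq> {0..T + 1}"
      proof safe
        fix r assume r: "r \<in> {p..q}"
        have "L * r \<le> L" using that r by (intro mult_left_le) auto
        moreover have "0 \<le> L * r" using that r by simp
        ultimately show "L * r \<in> {0..T + 1}" using that(2) unfolding atLeastAtMost_iff by linarith
      qed
      have "(H has_real_derivative G (L * s)) (at (L * s) within (\<lambda>s. L * s) ` {p..q})"
        by (rule DERIV_subset[OF H sub]) (rule subsetD[OF sub imageI[OF s]])
      moreover have "((\<lambda>s. L * s) has_real_derivative L) (at s within {p..q})"
        by (auto intro!: derivative_eq_intros)
      ultimately have "((\<lambda>s. H (L * s)) has_real_derivative G (L * s) * L) (at s within {p..q})"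
        using DERIV_image_chain[of H "G (L * s)" "\<lambda>s. L * s" s "{p..q}" L] by (simp add: o_def)
      from DERIV_cdivide[OF this, of L]
      show "((\<lambda>s. H (L * s) / L) has_vector_derivative G (L * s)) (at s within {p..q})"
        using that by (simp add: has_real_derivative_iff_has_vector_derivative)
    qed (use that in auto)
    then show "((\<lambda>s. G (L * s)) has_integral (H (L * q) - H (L * p)) / L) {p..q}"
      by (simp add: diff_divide_distrib)
  qed
  have HH: "H L = 2 * H (1/2 * L) - H 0" if "0 < L" "L < T + 1" for L
    using eq[of L] int[of L 0 "1/2"] int[of L "1/2" 1] that by (simp add: field_simps)
  have half: "G L = G (1/2 * L)" if L: "0 < L" "L < T + 1" for L
  proof (rule DERIV_unique)
    show "(H has_real_derivative G L) (at L)" using der L by simp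
    have "((\<lambda>L. 2 * H (1/2 * L) - H 0) has_real_derivative 2 * (G (1/2 * L) * (1/2)) - 0) (at L)"
    proof (intro DERIV_diff DERIV_cmult DERIV_const)
      have "((\<lambda>L. 1/2 * L) has_real_derivative 1/2) (at L)" by (auto intro!: derivative_eq_intros)
      moreover have "(H has_real_derivative G (1/2 * L)) (at (1/2 * L))" using L by (intro der) auto
      ultimately show "((\<lambda>L. H (1/2 * L)) has_real_derivative G (1/2 * L) * (1/2)) (at L)"
        using DERIV_chain2 by blast
    qed
    moreover have "eventually (\<lambda>L. H L = 2 * H (1/2 * L) - H 0) (nhds L)"
      using eventually_nhds_in_open[of "{0<..<T+1}" L] L HH by (auto elim!: eventually_mono)
    ultimately show "(H has_real_derivative G (1/2 * L)) (at L)"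
      using DERIV_cong_ev[of L L H "\<lambda>L. 2 * H (1/2 * L) - H 0" "G (1/2 * L)"] by simp
  qed
  show ?thesis
  proof (cases "T = 0")
    case False
    then have T0: "T > 0" using T by simp
    have G: "G T = G ((1/2) ^ n * T)" for n
    proof (induction n)
      case (Suc n)
      have "(1/2) ^ n * T \<le> T" using T0 by (intro mult_left_le_one_le power_le_one) auto
      then have "(1/2) ^ n * T < T + 1" by linarith
      then have "G ((1/2) ^ n * T) = G (1/2 * ((1/2) ^ n * T))" using T0 by (intro half) auto
      then show ?case using Suc by (simp add: mult.assoc)
    qed simp
    have "(\<lambda>n. (1/2) ^ n * T) \<longlonglongrightarrow> 0 * T"
      by (intro tendsto_intros LIMSEQ_power_zero) simp
    then have "(\<lambda>n. (1/2) ^ n * T) \<longlonglongrightarrow> 0" by simp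
    moreover have "isCont G 0" using cont by (simp add: continuous_on_eq_continuous_at)
    ultimately have "(\<lambda>n. G ((1/2) ^ n * T)) \<longlonglongrightarrow> G 0"
      by (rule isCont_tendsto_compose[rotated])
    then show ?thesis using LIMSEQ_unique[OF tendsto_const[of "G T"]] by (simp flip: G)
  qed simp
qed

text \<open>The sign of the first binary digit of \<open>s\<close>: positive on the left half of \<open>[0, 1)\<close>.\<close>

definition half_sign :: "real \<Rightarrow> real" where
  "half_sign s = (if s < 1/2 then 1 else - 1)"

lemma half_sign_measurable [measurable]: "half_sign \<in> borel_measurable borel"
  unfolding half_sign_def by measurable

lemma integral_unit_uniform_half_sign:
  fixes F :: "real \<Rightarrow> real"
  assumes cont: "continuous_on UNIV F"
  shows "(\<integral>s. half_sign s * F s \<partial>density lborel (\<lambda>s. ennreal (indicator {0..<1} s))) =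
    integral {0..1/2} F - integral {1/2..1} F"
proof -
  have m [measurable]: "F \<in> borel_measurable borel" by (rule borel_measurable_continuous_onI[OF cont])
  have si: "set_integrable lborel {p..q} F" for p q
    by (intro borel_integrable_atLeastAtMost' continuous_on_subset[OF cont]) simp
  have "(\<integral>s. half_sign s * F s \<partial>density lborel (\<lambda>s. ennreal (indicator {0..<1} s))) =
      (\<integral>s. indicator {0..<1} s * (half_sign s * F s) \<partial>lborel)"
    by (subst integral_density) auto
  also have "\<dots> = (\<integral>s. indicator {0..1/2} s *\<^sub>R F s - indicator {1/2..1} s *\<^sub>R F s \<partial>lborel)"
  proof (rule integral_cong_AE)
    have "AE s in lborel. s \<noteq> 1/2 \<and> s \<noteq> (1::real)"
      using AE_lborel_singleton[of "1/2::real"] AE_lborel_singleton[of "1::real"] by eventually_elim simp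
    then show "AE s in lborel. indicator {0..<1} s * (half_sign s * F s) =
        indicator {0..1/2} s *\<^sub>R F s - indicator {1/2..1} s *\<^sub>R F s"
      by eventually_elim (auto simp: half_sign_def indicator_def)
  qed (simp_all only: measurable_cong_sets[OF sets_lborel refl], measurable)
  also have "\<dots> = (LINT s:{0..1/2}|lborel. F s) - (LINT s:{1/2..1}|lborel. F s)"
    using si[of 0 "1/2"] si[of "1/2" 1] unfolding set_lebesgue_integral_def set_integrable_def
    by (rule Bochner_Integration.integral_diff)
  also have "\<dots> = integral {0..1/2} F - integral {1/2..1} F"
    by (simp add: set_borel_integral_eq_integral(2)[OF si])
  finally show ?thesis .
qed

section \<open>Invariance of the weak limit\<close>

context B_action
begin

text \<open>The integral of \<open>g\<close> along the orbit segment \<open>u (-s) x\<close> with \<open>0 \<le> s < 1/2\<close>, minus the integral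
  along the segment with \<open>1/2 \<le> s < 1\<close>.\<close>

definition half_difference :: "('a \<Rightarrow> real) \<Rightarrow> 'a \<Rightarrow> real" where
  "half_difference g x = (\<integral>s. half_sign s * g (u (-s) x) \<partial>unit_uniform)"

lemma half_sign_bound: "\<bar>half_sign s * r\<bar> = \<bar>r\<bar>"
  by (simp add: half_sign_def abs_mult)

lemma half_sign_u_measurable:
  assumes "g \<in> borel_measurable borel"
  shows "(\<lambda>(x, s). half_sign s * g (u (-s) x)) \<in> borel_measurable (borel \<Otimes>\<^sub>M borel)"
proof -
  note assms [measurable]
  show ?thesis by measurable
qed

lemma integral_half_difference:
  assumes \<mu>: "borel_prob \<mu>" and g: "g \<in> borel_measurable borel" "\<And>y. \<bar>g y\<bar> \<le> 1"
  shows "integrable (\<mu> \<Otimes>\<^sub>M unit_uniform) (\<lambda>(x, s). half_sign s * g (u (-s) x))"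
    and "(\<integral>x. half_difference g x \<partial>\<mu>) = (\<integral>(x, s). half_sign s * g (u (-s) x) \<partial>(\<mu> \<Otimes>\<^sub>M unit_uniform))"
    and "(\<integral>x. half_difference g x \<partial>\<mu>) = (\<integral>s. half_sign s * (\<integral>x. g (u (-s) x) \<partial>\<mu>) \<partial>unit_uniform)"
proof -
  interpret prob_space \<mu> using \<mu> by (simp add: borel_prob_def)
  have sm: "sets \<mu> = sets borel" using \<mu> by (simp add: borel_prob_def)
  interpret D: prob_space unit_uniform by (rule prob_space_unit)
  interpret pair_prob_space \<mu> unit_uniform ..
  have m: "(\<lambda>(x, s). half_sign s * g (u (-s) x)) \<in> borel_measurable (\<mu> \<Otimes>\<^sub>M unit_uniform)"
    by (subst borel_measurable_pair_cong[OF sm]) (simp_all add: half_sign_u_measurable[OF g(1), unfolded split_def] split_def)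
  show i: "integrable (\<mu> \<Otimes>\<^sub>M unit_uniform) (\<lambda>(x, s). half_sign s * g (u (-s) x))"
    by (rule P.integrable_const_bound[where B=1]) (auto simp: half_sign_bound g(2) m)
  show "(\<integral>x. half_difference g x \<partial>\<mu>) = (\<integral>(x, s). half_sign s * g (u (-s) x) \<partial>(\<mu> \<Otimes>\<^sub>M unit_uniform))"
    unfolding half_difference_def using integral_fst'[OF i] by simp
  have "(\<integral>x. half_difference g x \<partial>\<mu>) = (\<integral>s. \<integral>x. half_sign s * g (u (-s) x) \<partial>\<mu> \<partial>unit_uniform)"
    unfolding half_difference_def using Fubini_integral[OF i] by simp
  then show "(\<integral>x. half_difference g x \<partial>\<mu>) = (\<integral>s. half_sign s * (\<integral>x. g (u (-s) x) \<partial>\<mu>) \<partial>unit_uniform)"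
    by simp
qed

text \<open>The guess with \<open>w = (1 + \<theta> g) / 2\<close> has cross entropy
  \<open>ln 2 - \<theta> \<integral> half_difference g \<partial>\<mu>\<close> up to an error of order \<open>\<theta>\<^sup>2\<close>, which is compared with the lower
  bound \<open>\<delta> * ln 2\<close>.\<close>

lemma half_difference_bound:
  assumes \<mu>: "borel_prob \<mu>" "a_invariant \<phi> \<mu>" and dim: "has_leafwise_dim \<phi> \<mu> \<delta>"
    and g: "g \<in> borel_measurable borel" "\<And>y. \<bar>g y\<bar> \<le> 1" and \<theta>: "0 < \<theta>" "\<theta> \<le> 1/2"
  shows "\<theta> * (\<integral>x. half_difference g x \<partial>\<mu>) \<le> (1 - \<delta>) * ln 2 + 2 * \<theta>\<^sup>2"
proof -
  interpret prob_space \<mu> using \<mu> by (simp add: borel_prob_def)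
  have sm: "sets \<mu> = sets borel" using \<mu> by (simp add: borel_prob_def)
  interpret D: prob_space unit_uniform by (rule prob_space_unit)
  interpret pair_prob_space \<mu> unit_uniform ..
  define w where "w y = (1 + \<theta> * g y) / 2" for y
  have \<theta>g: "\<bar>\<theta> * g y\<bar> \<le> \<theta>" for y
    using \<theta>(1) mult_left_mono[OF g(2)[of y], of \<theta>] by (simp add: abs_mult)
  have w: "0 < w y" "w y < 1" for y
    using \<theta>g[of y] \<theta> by (auto simp: w_def)
  have wm: "w \<in> borel_measurable borel"
    unfolding w_def using g(1) by measurable
  define B where "B x s = ln 2 + 2 * \<theta>\<^sup>2 - \<theta> * (half_sign s * g (u (-s) x))" for x s
  have le: "0 \<le> - ln (digit_prob w (u (-s) x) s)" "- ln (digit_prob w (u (-s) x) s) \<le> B x s" for x s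
  proof -
    define z where "z = \<theta> * (half_sign s * g (u (-s) x))"
    have z: "\<bar>z\<bar> \<le> \<theta>" using \<theta>g[of "u (-s) x"] by (simp add: z_def half_sign_def)
    have dp: "digit_prob w (u (-s) x) s = (1 + z) / 2"
      by (simp add: digit_prob_def w_def z_def half_sign_def field_simps)
    show "0 \<le> - ln (digit_prob w (u (-s) x) s)"
      unfolding dp using z \<theta> by simp
    have "- ln ((1 + z) / 2) = ln 2 - ln (1 + z)"
      using z \<theta> by (subst ln_div) auto
    also have "\<dots> \<le> ln 2 - z + 2 * z\<^sup>2"
      using abs_ln_one_plus_x_minus_x_bound[of z] z \<theta> by simp
    also have "z\<^sup>2 \<le> \<theta>\<^sup>2" using z by (intro power2_le_iff_abs_le[THEN iffD2]) (use \<theta> in auto)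
    finally show "- ln (digit_prob w (u (-s) x) s) \<le> B x s"
      unfolding dp B_def z_def by simp
  qed
  have B0: "0 \<le> B x s" for x s
    by (rule order_trans[OF le])
  note i = integral_half_difference[OF \<mu>(1) g]
  have iB: "integrable (\<mu> \<Otimes>\<^sub>M unit_uniform) (case_prod B)"
    unfolding B_def[abs_def] split_def
    using i(1) by (intro Bochner_Integration.integrable_diff integrable_mult_right) (auto simp: split_def)
  have eB: "(\<integral>z. case_prod B z \<partial>(\<mu> \<Otimes>\<^sub>M unit_uniform)) = ln 2 + 2 * \<theta>\<^sup>2 - \<theta> * (\<integral>x. half_difference g x \<partial>\<mu>)"
  proof -
    have "(\<integral>z. case_prod B z \<partial>(\<mu> \<Otimes>\<^sub>M unit_uniform)) =
       (\<integral>z. ln 2 + 2 * \<theta>\<^sup>2 \<partial>(\<mu> \<Otimes>\<^sub>M unit_uniform)) -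
       (\<integral>z. \<theta> * (case z of (x, s) \<Rightarrow> half_sign s * g (u (-s) x)) \<partial>(\<mu> \<Otimes>\<^sub>M unit_uniform))"
      using i(1) unfolding B_def[abs_def]
      by (subst Bochner_Integration.integral_diff[symmetric]) (auto simp: split_def)
    then show ?thesis by (simp add: i(2) P.prob_space)
  qed
  have "ennreal (\<delta> * ln 2) \<le> unit_expectation \<mu> (\<lambda>x s. ennreal (- ln (digit_prob w (u (-s) x) s)))"
    by (rule leafwise_dim_le_cross_entropy[OF \<mu> dim wm w])
  also have "\<dots> \<le> unit_expectation \<mu> (\<lambda>x s. ennreal (B x s))"
    by (intro unit_expectation_mono ennreal_leI le)
  also have "\<dots> = (\<integral>\<^sup>+z. ennreal (case_prod B z) \<partial>(\<mu> \<Otimes>\<^sub>M unit_uniform))"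
  proof -
    have "(\<lambda>(x, s). ennreal (B x s)) \<in> borel_measurable (borel \<Otimes>\<^sub>M borel)"
      unfolding B_def using g(1) by measurable
    from unit_expectation_eq_nn_integral[OF sm this] show ?thesis by (simp add: split_def)
  qed
  also have "\<dots> = ennreal (\<integral>z. case_prod B z \<partial>(\<mu> \<Otimes>\<^sub>M unit_uniform))"
    using B0 by (intro nn_integral_eq_integral iB) (simp add: split_def)
  finally have "\<delta> * ln 2 \<le> (\<integral>z. case_prod B z \<partial>(\<mu> \<Otimes>\<^sub>M unit_uniform))"
    using B0 by (subst (asm) ennreal_le_iff) (simp_all add: split_def)
  then show ?thesis by (simp add: eB algebra_simps)
qed

lemma C_c_u: "g \<in> C_c \<Longrightarrow> (\<lambda>x. g (u s x)) \<in> C_c"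
proof -
  assume g: "g \<in> C_c"
  obtain K where K: "compact K" "\<And>x. x \<notin> K \<Longrightarrow> g x = 0" using C_c_support[OF g] by metis
  show ?thesis
  proof (rule C_cI)
    show "continuous_on UNIV (\<lambda>x. g (u s x))"
      by (rule continuous_on_compose2[OF C_c_continuous[OF g, of UNIV]]) (auto intro!: continuous_intros)
    show "compact (u (-s) ` K)"
      by (intro compact_continuous_image K(1) continuous_intros)
    fix x assume x: "x \<notin> u (-s) ` K"
    have "x = u (-s) (u s x)" by (simp add: u_u)
    with x have "u s x \<notin> K" by (metis imageI)
    then show "g (u s x) = 0" by (rule K(2))
  qed
qed

lemma C_c_a: "g \<in> C_c \<Longrightarrow> (\<lambda>x. g (a t x)) \<in> C_c"
proof -
  assume g: "g \<in> C_c"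
  obtain K where K: "compact K" "\<And>x. x \<notin> K \<Longrightarrow> g x = 0" using C_c_support[OF g] by metis
  show ?thesis
  proof (rule C_cI)
    show "continuous_on UNIV (\<lambda>x. g (a t x))"
      by (rule continuous_on_compose2[OF C_c_continuous[OF g, of UNIV]]) (auto intro!: continuous_intros)
    show "compact (a (-t) ` K)"
      by (intro compact_continuous_image K(1) continuous_intros)
    fix x assume x: "x \<notin> a (-t) ` K"
    have "x = a (-t) (a t x)" by (simp add: a_a)
    with x have "a t x \<notin> K" by (metis imageI)
    then show "g (a t x) = 0" by (rule K(2))
  qed
qed

lemma continuous_on_C_c_u:
  "g \<in> C_c \<Longrightarrow> continuous_on S (\<lambda>(x, s). g (u (-s) x))"
  unfolding split_def
  by (rule continuous_on_compose2[OF C_c_continuous[of g UNIV]]) (auto intro!: continuous_intros)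

lemma half_difference_eq:
  assumes g: "g \<in> C_c"
  shows "half_difference g x =
    integral {0..1/2} (\<lambda>s. g (u (-s) x)) - integral {1/2..1} (\<lambda>s. g (u (-s) x))"
  unfolding half_difference_def
proof (rule integral_unit_uniform_half_sign)
  show "continuous_on UNIV (\<lambda>s. g (u (- s) x))"
    by (rule continuous_on_compose2[OF C_c_continuous[OF g, of UNIV]]) (auto intro!: continuous_intros)
qed

lemma half_difference_C_c:
  assumes g: "g \<in> C_c"
  shows "half_difference g \<in> C_c"
proof -
  obtain K where K: "compact K" "\<And>x. x \<notin> K \<Longrightarrow> g x = 0" using C_c_support[OF g] by metis
  let ?K = "(\<lambda>(x, s). u s x) ` (K \<times> {0..1})"
  show ?thesis
  proof (rule C_cI)
    have c: "continuous_on UNIV (\<lambda>x. integral {p..q} (\<lambda>s. g (u (-s) x)))" for p q :: real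
      using integral_continuous_on_param[OF continuous_on_C_c_u[OF g], of UNIV p q]
      unfolding cbox_interval .
    show "continuous_on UNIV (half_difference g)"
      unfolding half_difference_eq[OF g, abs_def] by (intro continuous_on_diff c)
    show "compact ?K"
      using K(1) by (intro compact_continuous_image compact_Times continuous_on_subset[OF continuous_on_u]) auto
    fix x assume x: "x \<notin> ?K"
    have z: "g (u (-s) x) = 0" if s: "s \<in> {0..1}" for s
    proof (rule K(2), rule notI)
      assume "u (-s) x \<in> K"
      then have "u s (u (-s) x) \<in> ?K" using s by force
      with x show False by (simp add: u_u)
    qed
    have "integral {p..q} (\<lambda>s. g (u (-s) x)) = 0" if "0 \<le> p" "q \<le> 1" for p q
      using that by (subst integral_cong[of _ _ "\<lambda>_. 0"]) (auto intro: z)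
    then show "half_difference g x = 0"
      by (simp add: half_difference_eq[OF g])
  qed
qed

text \<open>Invariance under the maps \<open>u (- T)\<close> with \<open>T \<ge> 0\<close>, tested on \<^term>\<open>C_c\<close>, suffices.\<close>

lemma u_invariantI:
  assumes lc: "locally_compact_space (euclidean :: 'a topology)" and \<mu>: "borel_prob \<mu>"
    and eq: "\<And>g T. g \<in> C_c \<Longrightarrow> (\<And>y. \<bar>g y\<bar> \<le> 1) \<Longrightarrow> T \<ge> 0 \<Longrightarrow>
      (\<integral>x. g (u (- T) x) \<partial>\<mu>) = (\<integral>x. g x \<partial>\<mu>)"
  shows "u_invariant \<phi> \<mu>"
proof -
  interpret prob_space \<mu> using \<mu> by (simp add: borel_prob_def)
  have sm [measurable_cong]: "sets \<mu> = sets borel" using \<mu> by (simp add: borel_prob_def)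
  have neg: "distr \<mu> borel (u (- T)) = \<mu>" if T: "T \<ge> 0" for T
  proof (rule borel_measure_eqI_C_c[OF lc])
    show "prob_space (distr \<mu> borel (u (- T)))" by (rule prob_space_distr) measurable
    fix g :: "'a \<Rightarrow> real" assume g: "g \<in> C_c" "\<And>x. 0 \<le> g x" "\<And>x. g x \<le> 1"
    have "(\<integral>x. g x \<partial>distr \<mu> borel (u (- T))) = (\<integral>x. g (u (- T) x) \<partial>\<mu>)"
      by (rule integral_distr) (use C_c_measurable[OF g(1)] in measurable)
    also have "\<dots> = (\<integral>x. g x \<partial>\<mu>)" using g T by (intro eq) auto
    finally show "(\<integral>x. g x \<partial>distr \<mu> borel (u (- T))) = (\<integral>x. g x \<partial>\<mu>)" .
  qed (simp_all add: sm prob_space_axioms)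
  have "distr \<mu> borel (u s) = \<mu>" for s
  proof (cases "s \<le> 0")
    case True
    then show ?thesis using neg[of "- s"] by simp
  next
    case False
    then have "distr \<mu> borel (u s) = distr (distr \<mu> borel (u (- s))) borel (u s)"
      using neg[of s] by simp
    also have "\<dots> = distr \<mu> borel (\<lambda>x. x)"
      by (subst distr_distr) (auto simp: o_def u_u)
    also have "\<dots> = \<mu>" by (rule distr_id2) (simp add: sm)
    finally show ?thesis .
  qed
  then show ?thesis by (simp add: u_invariant_def)
qed

lemma weak_star_limit_C_c:
  "weak_star_limit \<mu> \<mu>' \<Longrightarrow> f \<in> C_c \<Longrightarrow> (\<lambda>k. \<integral>x. f x \<partial>\<mu> k) \<longlonglongrightarrow> (\<integral>x. f x \<partial>\<mu>')"
  by (simp add: weak_star_limit_def C_c_def)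

lemma limit_a_invariant:
  assumes \<mu>: "\<And>k. borel_prob (\<mu> k)" "\<And>k. a_invariant \<phi> (\<mu> k)" and lim: "weak_star_limit \<mu> \<mu>'"
    and f: "f \<in> C_c"
  shows "(\<integral>x. f (a t x) \<partial>\<mu>') = (\<integral>x. f x \<partial>\<mu>')"
proof -
  have "(\<integral>x. f (a t x) \<partial>\<mu> k) = (\<integral>x. f x \<partial>\<mu> k)" for k
  proof -
    have sm [measurable_cong]: "sets (\<mu> k) = sets borel" using \<mu> by (simp add: borel_prob_def)
    have "(\<integral>x. f x \<partial>distr (\<mu> k) borel (a t)) = (\<integral>x. f (a t x) \<partial>\<mu> k)"
      by (rule integral_distr) (use C_c_measurable[OF f] in measurable)
    then show ?thesis using \<mu>(2)[of k] by (simp add: a_invariant_def)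
  qed
  then show ?thesis
    using weak_star_limit_C_c[OF lim C_c_a[OF f, of t]] weak_star_limit_C_c[OF lim f]
    by (simp add: LIMSEQ_unique)
qed

text \<open>First let \<open>k\<close> tend to infinity for a fixed \<open>\<theta>\<close>, then let \<open>\<theta>\<close> tend to \<open>0\<close>; the opposite sign
  comes from \<open>- g\<close>.\<close>

lemma limit_half_difference:
  assumes \<mu>: "\<And>k. borel_prob (\<mu> k)" "\<And>k. a_invariant \<phi> (\<mu> k)"
    and dim: "\<And>k. has_leafwise_dim \<phi> (\<mu> k) (\<delta> k)" "\<delta> \<longlonglongrightarrow> 1"
    and lim: "weak_star_limit \<mu> \<mu>'"
    and g: "g \<in> C_c" "\<And>y. \<bar>g y\<bar> \<le> 1"
  shows "(\<integral>x. half_difference g x \<partial>\<mu>') = 0"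
proof -
  have le: "(\<integral>x. half_difference g x \<partial>\<mu>') \<le> 0" if g: "g \<in> C_c" "\<And>y. \<bar>g y\<bar> \<le> 1" for g
  proof (rule field_le_epsilon)
    fix e :: real assume e: "e > 0"
    \<comment> \<open>The bound divided by \<open>\<theta>\<close> has the limit \<open>2 * \<theta>\<close>, which is at most \<open>e\<close>.\<close>
    define \<theta> where "\<theta> = min (1/2) (e/2)"
    have \<theta>: "0 < \<theta>" "\<theta> \<le> 1/2" "2 * \<theta> \<le> e" using e by (auto simp: \<theta>_def)
    have "\<theta> * (\<integral>x. half_difference g x \<partial>\<mu>') \<le> (1 - 1) * ln 2 + 2 * \<theta>\<^sup>2"
    proof (rule LIMSEQ_le)
      show "(\<lambda>k. \<theta> * (\<integral>x. half_difference g x \<partial>\<mu> k)) \<longlonglongrightarrow> \<theta> * (\<integral>x. half_difference g x \<partial>\<mu>')"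
        by (intro tendsto_intros weak_star_limit_C_c[OF lim] half_difference_C_c g)
      show "(\<lambda>k. (1 - \<delta> k) * ln 2 + 2 * \<theta>\<^sup>2) \<longlonglongrightarrow> (1 - 1) * ln 2 + 2 * \<theta>\<^sup>2"
        by (intro tendsto_intros dim(2))
      show "\<exists>N. \<forall>k\<ge>N. \<theta> * (\<integral>x. half_difference g x \<partial>\<mu> k) \<le> (1 - \<delta> k) * ln 2 + 2 * \<theta>\<^sup>2"
        using half_difference_bound[OF \<mu> dim(1) C_c_measurable[OF g(1)] g(2) \<theta>(1,2)] by blast
    qed
    then have "\<theta> * (\<integral>x. half_difference g x \<partial>\<mu>') \<le> \<theta> * (2 * \<theta>)" by (simp add: power2_eq_square)
    then show "(\<integral>x. half_difference g x \<partial>\<mu>') \<le> 0 + e" using \<theta> by simp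
  qed
  have neg: "(\<lambda>x. - g x) \<in> C_c"
    using g(1) by (auto simp: C_c_def intro!: continuous_intros)
  have "half_difference (\<lambda>x. - g x) x = - half_difference g x" for x
    by (simp add: half_difference_def)
  then show ?thesis using le[OF g] le[OF neg] g(2) by simp
qed

lemma limit_integral_u:
  assumes \<mu>: "\<And>k. borel_prob (\<mu> k)" "\<And>k. a_invariant \<phi> (\<mu> k)"
    and dim: "\<And>k. has_leafwise_dim \<phi> (\<mu> k) (\<delta> k)" "\<delta> \<longlonglongrightarrow> 1"
    and \<mu>': "borel_prob \<mu>'" and lim: "weak_star_limit \<mu> \<mu>'"
    and g: "g \<in> C_c" "\<And>y. \<bar>g y\<bar> \<le> 1" and T: "T \<ge> 0"
  shows "(\<integral>x. g (u (- T) x) \<partial>\<mu>') = (\<integral>x. g x \<partial>\<mu>')"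
proof -
  interpret prob_space \<mu>' using \<mu>' by (simp add: borel_prob_def)
  have sm [measurable_cong]: "sets \<mu>' = sets borel" using \<mu>' by (simp add: borel_prob_def)
  have gm [measurable]: "g \<in> borel_measurable borel" by (rule C_c_measurable[OF g(1)])
  define G where "G s = (\<integral>x. g (u (-s) x) \<partial>\<mu>')" for s
  have cont: "continuous_on UNIV G"
    unfolding continuous_on_eq_continuous_at[OF open_UNIV]
  proof
    fix s :: real
    show "isCont G s"
    proof (unfold continuous_at_sequentially o_def, intro allI impI)
      fix X assume X: "X \<longlonglongrightarrow> s"
      show "(\<lambda>n. G (X n)) \<longlonglongrightarrow> G s" unfolding G_def
      proof (rule integral_dominated_convergence[where w="\<lambda>_. 1"])
        show "AE x in \<mu>'. (\<lambda>n. g (u (- X n) x)) \<longlonglongrightarrow> g (u (- s) x)"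
        proof (rule AE_I2)
          fix x
          have "continuous_on UNIV (\<lambda>s. g (u (- s) x))"
            by (rule continuous_on_compose2[OF C_c_continuous[OF g(1), of UNIV]]) (auto intro!: continuous_intros)
          then show "(\<lambda>n. g (u (- X n) x)) \<longlonglongrightarrow> g (u (- s) x)"
            by (rule continuous_on_tendsto_compose[OF _ X]) auto
        qed
        show "AE x in \<mu>'. norm (g (u (- X n) x)) \<le> 1" for n
          using g(2) by simp
      qed (simp, measurable)
    qed
  qed
  have "integral {0..1/2} (\<lambda>s. G (L * s)) = integral {1/2..1} (\<lambda>s. G (L * s))" if L: "L > 0" for L
  proof -
    \<comment> \<open>Precomposition with \<open>a (ln L)\<close> turns the unit segment into a segment of length \<open>L\<close>.\<close>
    let ?g = "\<lambda>x. g (a (ln L) x)"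
    have "(\<integral>x. ?g (u (- s) x) \<partial>\<mu>') = G (L * s)" for s
      using limit_a_invariant[OF \<mu> lim C_c_u[OF g(1)], of "- (L * s)" "ln L"] L
      by (simp add: a_u G_def)
    then have "(\<integral>x. half_difference ?g x \<partial>\<mu>') = (\<integral>s. half_sign s * G (L * s) \<partial>unit_uniform)"
      by (subst integral_half_difference(3)[OF \<mu>' C_c_measurable[OF C_c_a[OF g(1)]] g(2)]) simp
    also have "\<dots> = integral {0..1/2} (\<lambda>s. G (L * s)) - integral {1/2..1} (\<lambda>s. G (L * s))"
      by (rule integral_unit_uniform_half_sign, rule continuous_on_compose2[OF cont])
         (auto intro!: continuous_intros)
    finally show ?thesis
      using limit_half_difference[OF \<mu> dim lim C_c_a[OF g(1), of "ln L"]] g(2) by simp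
  qed
  from average_halves_imp_constant[OF cont this T] show ?thesis by (simp add: G_def)
qed

end

theorem theorem3p9:
  fixes \<phi> :: "real^2^2 \<Rightarrow> 'a \<Rightarrow> 'a::{second_countable_topology, t2_space}"
    and \<mu> :: "nat \<Rightarrow> 'a measure" and \<mu>' :: "'a measure"
    and \<delta> :: "nat \<Rightarrow> real"
  assumes "locally_compact_space (euclidean :: 'a topology)"
    and "continuous_B_action \<phi>"
    and "\<And>k. borel_prob (\<mu> k)"
    and "\<And>k. a_invariant \<phi> (\<mu> k)"
    and "\<And>k. a_ergodic \<phi> (\<mu> k)"
    and "\<And>k. u_free \<phi> (\<mu> k)"
    and "\<And>k. has_leafwise_dim \<phi> (\<mu> k) (\<delta> k)"
    and "\<delta> \<longlonglongrightarrow> 1"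
    and "borel_prob \<mu>'"
    and "weak_star_limit \<mu> \<mu>'"
  shows "u_invariant \<phi> \<mu>'"
proof -
  interpret B_action \<phi> by unfold_locales fact
  show ?thesis
    using limit_integral_u[OF assms(3,4,7-10)] by (rule u_invariantI[OF assms(1,9)])
qed

end
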